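(* Let $f_\lambda(z)=\lambda\sin(z)$ with $\lambda=e^{2\pi i p/q}$, where $p,q\in\mathbb{Z}$, $q\neq 0$ and $\gcd(p,q)=1$. Then every connected component of the Fatou set $F(f_\lambda)$ is bounded.
   Context: The Fatou set $F(f)$ of an entire function $f$ is the set of points having a neighbourhood on which the iterates $(f^n)_{n\in\mathbb{N}}$ form a normal family. *)

theory Defs
  imports "HOL-Analysis.Analysis"
begin

definition normal_family :: "complex set \<Rightarrow> (complex \<Rightarrow> complex) set \<Rightarrow> bool" where
  "normal_family U \<F> \<longleftrightarrow>
     (\<forall>g :: nat \<Rightarrow> complex \<Rightarrow> complex. (\<forall>n. g n \<in> \<F>) \<longrightarrow>
        (\<exists>r. strict_mono r \<and>
           ((\<exists>h. \<forall>K. compact K \<and> K \<subseteq> U \<longrightarrow> uniform_limit K (\<lambda>n. g (r n)) h sequentially)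
            \<or> (\<forall>K. compact K \<and> K \<subseteq> U \<longrightarrow>
                 (\<forall>B::real. eventually (\<lambda>n. \<forall>z\<in>K. B \<le> norm (g (r n) z)) sequentially)))))"

definition fatou_set :: "(complex \<Rightarrow> complex) \<Rightarrow> complex set" where
  "fatou_set f = {z. \<exists>U. open U \<and> z \<in> U \<and> normal_family U (range (\<lambda>n. f ^^ n))}"

end

(* Let f(z) = lam sin z with lam^Q = 1, so that 0 is a parabolic fixed point. Since f^Q is not the
   identity, the iterates f^(Q j) are unbounded on every disc around 0; hence 0 and all points that
   are eventually mapped to 0 lie outside the Fatou set F. The zeros of f^2 are 7-dense, so F contains
   no disc of radius 7.

   If the inverse branches of f^(Q n) could be continued over an attracting petal for all n, Bloch's
   theorem would produce arbitrarily large discs that contain no zero of f^2. So a lifted petal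
   contains a critical value, which gives a path from 0 to a critical value all of whose points have
   uniformly bounded orbits; in particular the critical orbits are bounded. Applying Bloch's theorem
   to inverse branches of f^n outside the postcritical set, and then to f^n itself, shows that orbits
   of points of F are bounded, locally uniformly.

   Lifting the path gives a periodic line with bounded orbits, and lifting that line gives a vertical
   path V, symmetric about 0, inside a vertical strip. Suppose that some X in F is horizontally long;
   translate it across 0 and consider the component G of 0 in the complement of X, -X and two
   translates of V on both sides of 0. If G is bounded, the maximum principle bounds the iterates near
   0, which is impossible. Otherwise G = -G leaves the region upwards and downwards between the
   translates of V, so it crosses X. Hence components of F have uniformly bounded horizontal extent,
   and as |f| grows exponentially with |Im z| a point of large imaginary part would escape. *)

theory Submission
  imports Defs "HOL-Complex_Analysis.Complex_Analysis"
begin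

section \<open>The sine map and its inverse branches\<close>

locale sine_map =
  fixes lam :: complex
  assumes norm_lam: "norm lam = 1"
begin

definition f :: "complex \<Rightarrow> complex"
  where "f = (\<lambda>z. lam * sin z)"

lemma lam_nonzero: "lam \<noteq> 0"
  using norm_lam by auto

lemma f_0 [simp]: "f 0 = 0"
  by (simp add: f_def)

lemma f_minus: "f (- z) = - f z"
  by (simp add: f_def)

lemma funpow_f_0 [simp]: "(f ^^ n) 0 = 0"
  by (induction n) auto

lemma funpow_f_minus: "(f ^^ n) (- z) = - (f ^^ n) z"
  by (induction n) (auto simp: f_minus)

lemma f_eq_0_iff: "f z = 0 \<longleftrightarrow> (\<exists>k::int. z = of_real (k * pi))"
  using lam_nonzero by (simp add: f_def sin_eq_0)

lemma f_periodic: "f (z + 2 * of_int k * of_real pi) = f z"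
proof -
  have "sin (z + 2 * of_int k * of_real pi) = sin z"
    by (subst complex_sin_eq) (auto intro!: bexI[of _ "of_int k"])
  then show ?thesis by (simp add: f_def)
qed

lemma funpow_f_periodic:
  assumes "n \<noteq> 0"
  shows "(f ^^ n) (z + 2 * of_int k * of_real pi) = (f ^^ n) z"
proof -
  obtain m where "n = Suc m" using assms by (cases n) auto
  then show ?thesis by (simp add: funpow_Suc_right f_periodic del: funpow.simps)
qed

lemma f_holomorphic: "f holomorphic_on S"
  unfolding f_def by (intro holomorphic_intros)

lemma funpow_f_holomorphic: "(f ^^ n) holomorphic_on S"
proof (induction n)
  case (Suc n)
  have "f \<circ> (f ^^ n) holomorphic_on S"
    by (intro holomorphic_on_compose Suc f_holomorphic)
  then show ?case by (simp add: o_def)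
qed (auto simp: id_def intro: holomorphic_intros)

lemma funpow_f_continuous: "continuous_on S (f ^^ n)"
  by (intro holomorphic_on_imp_continuous_on funpow_f_holomorphic)

text \<open>Here 4 |f z|^2 = 2 cosh (2 Im z) - 2 cos (2 Re z), and the cosine lies between -1 and 1;
  this gives cosh and sinh of |Im z| as bounds.\<close>

lemma norm_f_bounds:
  shows "norm (f z) \<le> (exp \<bar>Im z\<bar> + exp (- \<bar>Im z\<bar>)) / 2"
    and "norm (f z) \<ge> (exp \<bar>Im z\<bar> - exp (- \<bar>Im z\<bar>)) / 2"
proof -
  define Y where "Y = \<bar>Im z\<bar>"
  have Y: "Y \<ge> 0" by (simp add: Y_def)
  have eq: "norm (f z) ^ 2 = (exp (2 * Y) + exp (- (2 * Y)) - 2 * cos (2 * Re z)) / 4"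
    by (cases "Im z \<ge> 0") (auto simp: f_def norm_mult norm_lam norm_sin_squared Y_def exp_minus add_ac)
  have e: "exp (2 * Y) = exp Y ^ 2" "exp (- (2 * Y)) = exp (-Y) ^ 2" "exp Y * exp (- Y) = 1"
    by (simp_all flip: exp_double exp_add)
  have "norm (f z) ^ 2 \<le> ((exp Y + exp (-Y)) / 2) ^ 2"
    unfolding eq e(1,2) using e(3) cos_ge_minus_one[of "2 * Re z"]
    by (simp add: power2_eq_square field_simps del: cos_ge_minus_one)
  then show "norm (f z) \<le> (exp \<bar>Im z\<bar> + exp (- \<bar>Im z\<bar>)) / 2"
    unfolding Y_def by (rule power2_le_imp_le) (simp add: add_nonneg_nonneg)
  have "((exp Y - exp (-Y)) / 2) ^ 2 \<le> norm (f z) ^ 2"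
    unfolding eq e(1,2) using e(3) cos_le_one[of "2 * Re z"]
    by (simp add: power2_eq_square field_simps)
  then show "norm (f z) \<ge> (exp \<bar>Im z\<bar> - exp (- \<bar>Im z\<bar>)) / 2"
    unfolding Y_def by (rule power2_le_imp_le) simp
qed

text \<open>A preimage of k pi has height about log (2 k pi), so with k about exp |Im z| it lies
  near the height of z, and the period 2 pi adjusts the real part. With Bloch's theorem this density
  turns large derivatives into points that are mapped to 0.\<close>

lemma ball_7_contains_zero_of_f2:
  obtains y where "y \<in> ball z 7" "f (f y) = 0"
proof -
  define Y0 where "Y0 = \<bar>Im z\<bar>"
  define k where "k = \<lceil>exp Y0\<rceil>"
  have k: "real_of_int k \<ge> exp Y0" "real_of_int k \<le> exp Y0 + 1"
    unfolding k_def by linarith+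
  have Y0: "exp Y0 \<ge> 1" by (simp add: Y0_def)
  have k1: "k \<ge> 0" using k(1) Y0 by linarith
  define y' where "y' = Arcsin (of_real (k * pi) / lam)"
  have fy': "f y' = of_real (k * pi)"
    using lam_nonzero by (simp add: f_def y'_def)
  \<comment> \<open>Since f is odd, the sign of the preimage can be chosen to put it in the
    half-plane of z.\<close>
  define y1 where "y1 = (if sgn (Im y') = sgn (Im z) \<or> Im z = 0 then y' else - y')"
  have y1: "\<bar>Im y1\<bar> = \<bar>Im y'\<bar>" "Im y' \<noteq> 0 \<Longrightarrow> Im z \<noteq> 0 \<Longrightarrow> sgn (Im y1) = sgn (Im z)"
    by (auto simp: y1_def sgn_if split: if_splits)
  define Y where "Y = \<bar>Im y1\<bar>"
  have nf: "norm (f y1) = k * pi"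
    proof -
    have "norm (f y1) = norm (complex_of_real (k * pi))"
      using fy' by (auto simp: y1_def f_minus simp del: of_real_mult)
    then show ?thesis using k(1) Y0 by (simp del: of_real_mult)
  qed
  have "f (f y') = 0"
    unfolding fy' f_eq_0_iff by blast
  then have "f (f y1) = 0"
    by (auto simp: y1_def f_minus)
  define m where "m = round ((Re z - Re y1) / (2 * pi))"
  define y where "y = y1 + 2 * of_int m * of_real pi"
  have "\<bar>of_int m - (Re z - Re y1) / (2 * pi)\<bar> \<le> 1 / 2"
    unfolding m_def by (rule of_int_round_abs_le)
  then have "\<bar>of_int m - (Re z - Re y1) / (2 * pi)\<bar> * (2 * pi) \<le> 1 / 2 * (2 * pi)"
    by (rule mult_right_mono) auto
  then have "\<bar>(of_int m - (Re z - Re y1) / (2 * pi)) * (2 * pi)\<bar> \<le> pi"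
    by (simp add: abs_mult)
  moreover have "(of_int m - (Re z - Re y1) / (2 * pi)) * (2 * pi) = Re y - Re z"
    by (simp add: y_def field_simps)
  ultimately have Re: "\<bar>Re y - Re z\<bar> \<le> pi" by simp
  have Y_nonneg: "Y \<ge> 0" by (simp add: Y_def)
  define e where "e = exp (- Y)"
  have e: "e \<le> 1" "e > 0" using Y_nonneg by (auto simp: e_def)
  define kp where "kp = k * pi"
  have low: "exp Y \<ge> 2 * (k * pi) - 1"
  proof -
    have "kp \<le> (exp Y + e) / 2"
      using norm_f_bounds(1)[of y1] unfolding nf Y_def[symmetric] e_def[symmetric] kp_def[symmetric] .
    then show ?thesis unfolding kp_def[symmetric] using e(1) by argo
  qed
  have up: "exp Y \<le> 2 * (k * pi) + 1"
  proof -
    have "(exp Y - e) / 2 \<le> kp"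
      using norm_f_bounds(2)[of y1] unfolding nf Y_def[symmetric] e_def[symmetric] kp_def[symmetric] .
    then show ?thesis unfolding kp_def[symmetric] using e(1) by argo
  qed
  have "exp Y0 * 3 \<le> k * pi"
    using pi_gt3 k1 by (intro mult_mono[OF k(1)]) simp_all
  then have "exp Y0 \<le> exp Y" using low Y0 by linarith
  then have Y_ge: "Y0 \<le> Y" by simp
  \<comment> \<open>exp Y <= 2 k pi + 1 <= 13.8 exp Y0 < 2.5^3 exp Y0, and 2.5 = 1 + 1 + 1/2 is the
    quadratic Taylor bound below e.\<close>
  have "k * pi \<le> (2 * exp Y0) * 3.2"
  proof (rule mult_mono)
    show "real_of_int k \<le> 2 * exp Y0" using k(2) Y0 by linarith
  qed (use pi_approx in auto)
  moreover have "q \<le> X * (2.5 * 2.5 * 2.5)" if "p \<le> (2 * X) * 3.2" "q \<le> 2 * p + 1" "1 \<le> X" for p q X :: real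
    using that by simp
  ultimately have "exp Y \<le> exp Y0 * (2.5 * 2.5 * 2.5)" using up Y0 by blast
  also have "\<dots> \<le> exp Y0 * (exp 1 * exp 1 * exp 1)"
    using exp_lower_Taylor_quadratic[of 1]
    by (intro mult_left_mono mult_mono) auto
  also have "\<dots> = exp (Y0 + 3)" by (simp flip: exp_add)
  finally have Y_le: "Y \<le> Y0 + 3" by simp
  have Im: "\<bar>Im y - Im z\<bar> \<le> 3"
  proof (cases "Im z = 0")
    case True
    then show ?thesis using Y_ge Y_le by (simp add: y_def Y_def Y0_def)
  next
    case False
    then have "Im y' \<noteq> 0" using Y_ge y1 by (auto simp: Y_def Y0_def)
    with False y1 have "sgn (Im y1) = sgn (Im z)" by blast
    then show ?thesis using Y_ge Y_le
      by (auto simp: y_def Y_def Y0_def sgn_if split: if_splits)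
  qed
  have "norm (y - z) \<le> \<bar>Re (y - z)\<bar> + \<bar>Im (y - z)\<bar>" by (rule cmod_le)
  also have "\<dots> < 7" using Re Im pi_approx by simp
  finally have "y \<in> ball z 7" by (simp add: dist_norm norm_minus_commute)
  moreover have "f (f y) = 0"
    using \<open>f (f y1) = 0\<close> f_periodic by (simp add: y_def)
  ultimately show ?thesis by (rule that)
qed

text \<open>G / lam omits the critical values 1 and -1 of the sine, so a holomorphic arccosine
  exists on S. Points with equal sine differ by a translation or a reflection; composing with it
  corrects the value at x.\<close>

lemma arcsin_lift:
  assumes hol: "G holomorphic_on S" and S: "contractible S" and "x \<in> S" and base: "f y = G x"
    and avoid: "lam \<notin> G ` S" "- lam \<notin> G ` S"
  obtains H where "H holomorphic_on S" "H x = y" "\<And>w. w \<in> S \<Longrightarrow> f (H w) = G w"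
proof -
  have hol': "(\<lambda>w. G w / lam) holomorphic_on S"
    using lam_nonzero by (intro holomorphic_intros hol) auto
  have "G w / lam \<noteq> 1 \<and> G w / lam \<noteq> - 1" if "w \<in> S" for w
  proof -
    have "G w \<noteq> lam" "G w \<noteq> - lam" using avoid that by force+
    then show ?thesis using lam_nonzero by (simp add: divide_eq_eq)
  qed
  then obtain h where h: "h holomorphic_on S" "\<And>w. w \<in> S \<Longrightarrow> G w / lam = cos (h w)"
    using contractible_imp_holomorphic_arccos[OF hol' S] by metis
  define h' where "h' w = of_real pi / 2 - h w" for w
  have h': "h' holomorphic_on S" unfolding h'_def by (intro holomorphic_intros h)
  have fh': "f (h' w) = G w" if "w \<in> S" for w
    using h(2)[OF that] lam_nonzero by (simp add: f_def h'_def cos_sin_eq divide_eq_eq mult.commute)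
  have "lam * sin y = lam * sin (h' x)"
    using fh'[OF \<open>x \<in> S\<close>] base by (simp add: f_def)
  then have "sin y = sin (h' x)" using lam_nonzero by simp
  then consider n where "n \<in> \<int>" "y = h' x + of_real (2 * n * pi)"
    | n where "n \<in> \<int>" "y = - h' x + of_real ((2 * n + 1) * pi)"
    unfolding complex_sin_eq by blast
  then show ?thesis
  proof cases
    case 1
    show ?thesis
    proof
      show "(\<lambda>w. h' w + of_real (2 * n * pi)) holomorphic_on S" by (intro holomorphic_intros h')
      have "sin (h' w + of_real (2 * n * pi)) = sin (h' w)" for w
        by (subst complex_sin_eq) (use 1 in auto)
      then show "f (h' w + of_real (2 * n * pi)) = G w" if "w \<in> S" for w
        using fh'[OF that] unfolding f_def by metis
    qed (use 1 in auto)
  next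
    case 2
    show ?thesis
    proof
      show "(\<lambda>w. - h' w + of_real ((2 * n + 1) * pi)) holomorphic_on S" by (intro holomorphic_intros h')
      have "sin (- h' w + of_real ((2 * n + 1) * pi)) = sin (h' w)" for w
        by (subst complex_sin_eq) (use 2 in auto)
      then show "f (- h' w + of_real ((2 * n + 1) * pi)) = G w" if "w \<in> S" for w
        using fh'[OF that] unfolding f_def by metis
    qed (use 2 in auto)
  qed
qed

text \<open>One factor f is lifted at a time, and the process stops only when a partial lift takes a
  critical value of f. For petals the second outcome is wanted, for discs off the critical orbits
  the first.\<close>

lemma iterated_lift:
  assumes hol: "G0 holomorphic_on S" and S: "contractible S" and x: "x \<in> S"
    and base: "(f ^^ n) z = G0 x"
  obtains (lift) G where "G holomorphic_on S" "G x = z" "\<And>w. w \<in> S \<Longrightarrow> (f ^^ n) (G w) = G0 w"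
    | (critical) j G where "j < n" "G holomorphic_on S" "G x = (f ^^ (n - j)) z"
        "\<And>w. w \<in> S \<Longrightarrow> (f ^^ j) (G w) = G0 w" "lam \<in> G ` S \<or> - lam \<in> G ` S"
proof -
  have "(\<exists>G. G holomorphic_on S \<and> G x = (f ^^ (n - m)) z \<and> (\<forall>w\<in>S. (f ^^ m) (G w) = G0 w)) \<or>
        (\<exists>j<n. \<exists>G. G holomorphic_on S \<and> G x = (f ^^ (n - j)) z \<and> (\<forall>w\<in>S. (f ^^ j) (G w) = G0 w) \<and>
            (lam \<in> G ` S \<or> - lam \<in> G ` S))" if "m \<le> n" for m
    using that
  proof (induction m)
    case 0
    have "G0 holomorphic_on S \<and> G0 x = (f ^^ (n - 0)) z \<and> (\<forall>w\<in>S. (f ^^ 0) (G0 w) = G0 w)"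
      using hol base by simp
    then show ?case by blast
  next
    case (Suc m)
    then consider G where "G holomorphic_on S" "G x = (f ^^ (n - m)) z"
         "\<forall>w\<in>S. (f ^^ m) (G w) = G0 w" "lam \<notin> G ` S" "- lam \<notin> G ` S"
      | "\<exists>j<n. \<exists>G. G holomorphic_on S \<and> G x = (f ^^ (n - j)) z \<and> (\<forall>w\<in>S. (f ^^ j) (G w) = G0 w) \<and>
            (lam \<in> G ` S \<or> - lam \<in> G ` S)"
      using Suc_le_lessD[of m n] by (metis less_imp_le)
    then show ?case
    proof cases
      case 1
      have "n - m = Suc (n - Suc m)" using Suc.prems by simp
      then have "f ((f ^^ (n - Suc m)) z) = G x" using 1 by simp
      then obtain H where "H holomorphic_on S" "H x = (f ^^ (n - Suc m)) z"
         "\<And>w. w \<in> S \<Longrightarrow> f (H w) = G w"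
        using arcsin_lift[OF 1(1) S x] 1 by metis
      then have "H holomorphic_on S \<and> H x = (f ^^ (n - Suc m)) z \<and> (\<forall>w\<in>S. (f ^^ Suc m) (H w) = G0 w)"
        using 1 by (simp add: funpow_Suc_right del: funpow.simps)
      then show ?thesis by blast
    qed blast
  qed
  from this[of n] show ?thesis using lift critical by auto
qed

end

section \<open>Iterates near the parabolic fixed point and the Fatou set\<close>

locale parabolic_sine = sine_map +
  fixes Q :: nat
  assumes Q_pos: "Q > 0" and lam_power: "lam ^ Q = 1"
begin

lemma funpow_f_deriv_0: "((f ^^ n) has_field_derivative lam ^ n) (at 0)"
proof (induction n)
  case 0
  show ?case by (simp add: id_def)
next
  case (Suc n)
  have "(f has_field_derivative lam) (at ((f ^^ n) 0))"
    unfolding funpow_f_0 by (simp add: f_def) (auto intro!: derivative_eq_intros)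
  from DERIV_chain[OF this Suc] show ?case by (simp add: o_def)
qed

lemma funpow_f_at_pi: "n > 0 \<Longrightarrow> (f ^^ n) (of_real pi) = 0"
proof -
  assume "n > 0"
  then obtain m where "n = Suc m" by (cases n) auto
  moreover have "f (of_real pi) = 0" by (simp add: f_def sin_of_real)
  ultimately show ?thesis by (simp add: funpow_Suc_right del: funpow.simps)
qed

text \<open>f^Q maps pi to 0, so f^Q - id is not constant and has a zero of finite order at 0. The
  order exceeds 1 because the derivative there is lam^Q - 1 = 0.\<close>

lemma parabolic_expansion:
  obtains k G where "k \<ge> 1" "G holomorphic_on UNIV" "G 0 \<noteq> 0"
    "\<And>z. (f ^^ Q) z = z + z ^ Suc k * G z"
proof -
  define K where "K z = (f ^^ Q) z - z" for z
  have holK: "K holomorphic_on S" for S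
    unfolding K_def by (intro holomorphic_intros funpow_f_holomorphic)
  have "K 0 = 0" "K (of_real pi) \<noteq> 0"
    using funpow_f_at_pi[OF Q_pos] by (simp_all add: K_def)
  then have nonconst: "\<not> K constant_on UNIV"
    unfolding constant_on_def by (metis UNIV_I)
  obtain g r n where g: "0 < n" "0 < r" "g holomorphic_on ball 0 r"
      "\<And>w. w \<in> ball 0 r \<Longrightarrow> K w = (w - 0) ^ n * g w" "\<And>w. w \<in> ball 0 r \<Longrightarrow> g w \<noteq> 0"
    using holomorphic_factor_zero_nonconstant[OF holK open_UNIV connected_UNIV UNIV_I \<open>K 0 = 0\<close> nonconst]
    by metis
  have "n \<noteq> 1"
  proof
    assume "n = 1"
    have "(K has_field_derivative lam ^ Q - 1) (at 0)"
      unfolding K_def using funpow_f_deriv_0[of Q] by (auto intro!: derivative_eq_intros)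
    moreover have "((\<lambda>w. w * g w) has_field_derivative g 0) (at 0)"
    proof -
      have "g field_differentiable (at 0)"
        using g(2,3) by (intro holomorphic_on_imp_differentiable_at[of _ "ball 0 r"]) auto
      then obtain g' where "(g has_field_derivative g') (at 0)"
        by (auto simp: field_differentiable_def)
      then show ?thesis by (auto intro!: derivative_eq_intros)
    qed
    then have "(K has_field_derivative g 0) (at 0)"
      by (rule has_field_derivative_transform_within_open[where S = "ball 0 r"])
        (use g \<open>n = 1\<close> in auto)
    ultimately have "g 0 = lam ^ Q - 1" by (rule DERIV_unique[rotated])
    then show False using lam_power g(2,5) by auto
  qed
  define k where "k = n - 1"
  have k: "k \<ge> 1" "n = Suc k" using g(1) \<open>n \<noteq> 1\<close> by (auto simp: k_def)
  \<comment> \<open>Away from 0 the quotient is holomorphic and near 0 it agrees with g, so G is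
    entire.\<close>
  define G where "G z = (if z = 0 then g 0 else K z / z ^ n)" for z
  have "G holomorphic_on ball 0 r"
    by (rule holomorphic_transform[OF g(3)]) (use g(4) in \<open>auto simp: G_def\<close>)
  moreover have "G holomorphic_on - {0}"
  proof (rule holomorphic_transform)
    show "(\<lambda>z. K z / z ^ n) holomorphic_on - {0}" by (intro holomorphic_intros holK) auto
  qed (auto simp: G_def)
  ultimately have "G holomorphic_on (ball 0 r \<union> - {0})"
    by (rule holomorphic_on_Un) auto
  moreover have "ball 0 r \<union> - {0} = (UNIV :: complex set)" using g(2) by auto
  ultimately have "G holomorphic_on UNIV" by simp
  moreover have "G 0 \<noteq> 0" using g by (simp add: G_def)
  moreover have "(f ^^ Q) z = z + z ^ Suc k * G z" for z
    using \<open>K 0 = 0\<close> k by (auto simp: G_def K_def)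
  ultimately show ?thesis using that k(1) by blast
qed

text \<open>The coefficient of z^(k+1) in f^(Q j) is j G(0). It grows with j, while a bound for the
  iterates on a disc would bound it by Cauchy's estimate.\<close>

lemma iterates_unbounded_near_0:
  assumes "r > 0"
  obtains N where "\<And>j. j \<ge> N \<Longrightarrow> \<exists>z\<in>ball 0 r. B < norm ((f ^^ (Q * j)) z)"
proof -
  obtain k G where kG: "k \<ge> 1" "G holomorphic_on UNIV" "G 0 \<noteq> 0"
    and expand: "\<And>z. (f ^^ Q) z = z + z ^ Suc k * G z"
    using parabolic_expansion by metis
  have iter: "\<exists>H. H holomorphic_on UNIV \<and> H 0 = of_nat j * G 0 \<and>
      (\<forall>z. (f ^^ (Q * j)) z = z + z ^ Suc k * H z)" for j
  proof (induction j)
    case 0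
    show ?case by (intro exI[of _ "\<lambda>_. 0"]) auto
  next
    case (Suc j)
    then obtain H where H: "H holomorphic_on UNIV" "H 0 = of_nat j * G 0"
      "\<And>z. (f ^^ (Q * j)) z = z + z ^ Suc k * H z" by blast
    \<comment> \<open>Inserting u = z (1 + z^k H z) into u + u^(k+1) G u gives the remainder of the
      next iterate.\<close>
    define H' where "H' z = (1 + z ^ k * H z) ^ Suc k * G ((f ^^ (Q * j)) z) + H z" for z
    have "(G \<circ> (f ^^ (Q * j))) holomorphic_on UNIV"
      by (intro holomorphic_on_compose funpow_f_holomorphic holomorphic_on_subset[OF kG(2)]) auto
    then have "(\<lambda>z. G ((f ^^ (Q * j)) z)) holomorphic_on UNIV" by (simp add: o_def)
    then have "H' holomorphic_on UNIV"
      unfolding H'_def by (intro holomorphic_intros H)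
    moreover have "H' 0 = of_nat (Suc j) * G 0"
    proof -
      have 0: "0 ^ k = (0 :: complex)" using kG(1) by simp
      show ?thesis unfolding H'_def H(2) 0 by (simp add: distrib_right)
    qed
    moreover have "(f ^^ (Q * Suc j)) z = z + z ^ Suc k * H' z" for z
    proof -
      define u where "u = (f ^^ (Q * j)) z"
      have u: "u = z * (1 + z ^ k * H z)" unfolding u_def H(3) by (simp add: algebra_simps)
      have "(f ^^ (Q * Suc j)) z = (f ^^ Q) u"
        by (simp add: u_def funpow_add)
      also have "\<dots> = u + u ^ Suc k * G u" by (rule expand)
      also have "u ^ Suc k = z ^ Suc k * (1 + z ^ k * H z) ^ Suc k"
        unfolding u by (rule power_mult_distrib)
      finally have "(f ^^ (Q * Suc j)) z = u + z ^ Suc k * ((1 + z ^ k * H z) ^ Suc k * G u)"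
        by (simp only: mult.assoc)
      moreover have "u = z + z ^ Suc k * H z" unfolding u_def by (rule H(3))
      ultimately show ?thesis
        unfolding H'_def u_def[symmetric] distrib_left by (simp only: add_ac)
    qed
    ultimately show ?case by blast
  qed
  define \<rho> where "\<rho> = r / 2"
  have \<rho>: "0 < \<rho>" "\<rho> < r" using assms by (auto simp: \<rho>_def)
  \<comment> \<open>Bounds |H| on the circle of radius \<open>\<rho>\<close> when the iterate is
    bounded by B there.\<close>
  define C where "C = (B + \<rho>) / \<rho> ^ Suc k"
  show ?thesis
  proof (rule that[of "nat (\<lceil>C / norm (G 0)\<rceil> + 1)"], rule ccontr)
    fix j assume j: "j \<ge> nat (\<lceil>C / norm (G 0)\<rceil> + 1)"
      and "\<not> (\<exists>z\<in>ball 0 r. B < norm ((f ^^ (Q * j)) z))"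
    then have bound: "norm ((f ^^ (Q * j)) z) \<le> B" if "z \<in> ball 0 r" for z
      using that by (auto simp: not_less)
    obtain H where H: "H holomorphic_on UNIV" "H 0 = of_nat j * G 0"
      "\<And>z. (f ^^ (Q * j)) z = z + z ^ Suc k * H z" using iter[of j] by blast
    have "norm ((deriv ^^ 0) H 0) \<le> fact 0 * C / \<rho> ^ 0"
    proof (rule Cauchy_inequality)
      fix x :: complex assume x: "norm (0 - x) = \<rho>"
      then have "x \<noteq> 0" using \<rho> by auto
      then have "H x = ((f ^^ (Q * j)) x - x) / x ^ Suc k" by (simp add: H(3))
      moreover have "norm ((f ^^ (Q * j)) x - x) \<le> B + \<rho>"
        using norm_triangle_ineq4[of "(f ^^ (Q * j)) x" x] bound[of x] x \<rho> by simp
      ultimately show "norm (H x) \<le> C"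
        using x \<rho> by (simp add: C_def norm_divide norm_power divide_right_mono norm_mult)
    qed (use \<rho> H(1) in \<open>auto intro: holomorphic_on_subset holomorphic_on_imp_continuous_on\<close>)
    then have "j * norm (G 0) \<le> C" by (simp add: H(2) norm_mult)
    then have "j \<le> C / norm (G 0)" using kG(3) by (simp add: field_simps)
    then show False using j by linarith
  qed
qed

section \<open>Invariance of the Fatou set, and points outside it\<close>

abbreviation F :: "complex set"
  where "F \<equiv> fatou_set f"

lemma open_F: "open F"
proof (subst open_subopen, intro ballI)
  fix z assume "z \<in> F"
  then obtain U where "open U" "z \<in> U" "normal_family U (range (\<lambda>n. f ^^ n))"
    by (auto simp: fatou_set_def)
  then show "\<exists>T. open T \<and> z \<in> T \<and> T \<subseteq> F" by (auto simp: fatou_set_def)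
qed

text \<open>As 0 is fixed, the iterates cannot tend to infinity around it; a uniform limit along a
  subsequence of f^(Q n) would bound that subsequence on a disc, against
  \<open>iterates_unbounded_near_0\<close>.\<close>

lemma zero_notin_F: "0 \<notin> F"
proof
  assume "0 \<in> F"
  then obtain U where U: "open U" "0 \<in> U" "normal_family U (range (\<lambda>n. f ^^ n))"
    by (auto simp: fatou_set_def)
  obtain \<rho> where \<rho>: "\<rho> > 0" "cball 0 \<rho> \<subseteq> U"
    using U open_contains_cball by blast
  define g where "g n = f ^^ (Q * n)" for n
  have "\<forall>n. g n \<in> range (\<lambda>n. f ^^ n)" by (auto simp: g_def)
  note normal = U(3)[unfolded normal_family_def, THEN spec, THEN mp, OF this]
  then obtain r where r: "strict_mono r" and
    alt: "(\<exists>h. \<forall>K. compact K \<and> K \<subseteq> U \<longrightarrow> uniform_limit K (\<lambda>n. g (r n)) h sequentially)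
            \<or> (\<forall>K. compact K \<and> K \<subseteq> U \<longrightarrow>
                 (\<forall>B::real. eventually (\<lambda>n. \<forall>z\<in>K. B \<le> norm (g (r n) z)) sequentially))"
    using normal by blast
  have "\<exists>h. uniform_limit (cball 0 \<rho>) (\<lambda>n. g (r n)) h sequentially"
    using alt
  proof
    assume *: "\<forall>K. compact K \<and> K \<subseteq> U \<longrightarrow>
                 (\<forall>B::real. eventually (\<lambda>n. \<forall>z\<in>K. B \<le> norm (g (r n) z)) sequentially)"
    have "eventually (\<lambda>n. \<forall>z\<in>cball 0 \<rho>. 1 \<le> norm (g (r n) z)) sequentially"
      using *[rule_format, of "cball 0 \<rho>" 1] \<rho> by simp
    then obtain n where "\<forall>z\<in>cball 0 \<rho>. 1 \<le> norm (g (r n) z)"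
      by (auto simp: eventually_sequentially)
    then have "1 \<le> norm (g (r n) 0)" using \<rho> by auto
    then show ?thesis by (simp add: g_def)
  qed (use \<rho>(2) compact_cball in blast)
  then obtain h where h: "uniform_limit (cball 0 \<rho>) (\<lambda>n. g (r n)) h sequentially" ..
  obtain N where N: "\<And>n. n \<ge> N \<Longrightarrow> \<forall>z\<in>cball 0 \<rho>. dist (g (r n) z) (h z) < 1"
    using uniform_limitD[OF h, of 1] by (auto simp: eventually_sequentially)
  have "continuous_on (cball 0 \<rho>) (g (r N))"
    unfolding g_def by (rule funpow_f_continuous)
  then have "bounded (g (r N) ` cball 0 \<rho>)"
    by (intro compact_imp_bounded compact_continuous_image) auto
  then obtain B where "\<forall>y\<in>g (r N) ` cball 0 \<rho>. norm y \<le> B"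
    unfolding bounded_iff by blast
  then have B: "\<And>z. z \<in> cball 0 \<rho> \<Longrightarrow> norm (g (r N) z) \<le> B"
    by blast
  have bound: "norm (g (r n) z) \<le> B + 2" if "n \<ge> N" "z \<in> cball 0 \<rho>" for n z
  proof -
    have "dist (g (r n) z) (g (r N) z) < 2"
      using N[OF that(1), rule_format, OF that(2)] N[OF order_refl, rule_format, OF that(2)]
        dist_triangle2[of "g (r n) z" "g (r N) z" "h z"]
      by linarith
    then have "norm (g (r n) z) \<le> norm (g (r N) z) + 2"
      using norm_triangle_sub[of "g (r n) z" "g (r N) z"] by (simp add: dist_norm)
    then show ?thesis using B[OF that(2)] by simp
  qed
  obtain M where M: "\<And>j. j \<ge> M \<Longrightarrow> \<exists>z\<in>ball 0 \<rho>. B + 2 < norm ((f ^^ (Q * j)) z)"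
    using iterates_unbounded_near_0[OF \<rho>(1)] by metis
  define n where "n = max N M"
  have "r n \<ge> M" using seq_suble[OF r, of n] by (simp add: n_def)
  then obtain z where "z \<in> ball 0 \<rho>" "B + 2 < norm (g (r n) z)"
    using M unfolding g_def by blast
  moreover have "norm (g (r n) z) \<le> B + 2"
    using bound[of n z] \<open>z \<in> ball 0 \<rho>\<close> by (simp add: n_def)
  ultimately show False by simp
qed

text \<open>f is open, so the image V of a small disc is a neighbourhood of \<open>f z\<close>. A
  sequence of iterates on V is pulled back to U by composition with f, which raises each exponent by
  one.\<close>

lemma f_in_F:
  assumes "z \<in> F"
  shows "f z \<in> F"
proof -
  obtain U where U: "open U" "z \<in> U" "normal_family U (range (\<lambda>n. f ^^ n))"
    using assms by (auto simp: fatou_set_def)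
  obtain \<rho> where \<rho>: "\<rho> > 0" "cball z \<rho> \<subseteq> U"
    using U open_contains_cball by blast
  define V where "V = f ` ball z \<rho>"
  have "open V"
    unfolding V_def
  proof (rule open_mapping_thm[of f UNIV])
    show "\<not> f constant_on UNIV"
    proof
      assume "f constant_on UNIV"
      then have "f (of_real (pi / 2)) = f 0" unfolding constant_on_def by (metis UNIV_I)
      moreover have "f (of_real (pi / 2)) = lam"
        by (simp add: f_def sin_of_real del: of_real_divide)
      ultimately show False using lam_nonzero by simp
    qed
  qed (auto intro: f_holomorphic)
  moreover have "f z \<in> V" using \<rho> by (auto simp: V_def)
  moreover have "normal_family V (range (\<lambda>n. f ^^ n))"
    unfolding normal_family_def
  proof (intro allI impI)
    fix g :: "nat \<Rightarrow> complex \<Rightarrow> complex" assume "\<forall>n. g n \<in> range (\<lambda>n. f ^^ n)"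
    then have "\<forall>n. \<exists>s. g n = f ^^ s" by blast
    then obtain s where s: "\<And>n. g n = f ^^ s n" by metis
    define g' where "g' n = f ^^ Suc (s n)" for n
    have g': "g' n w = g n (f w)" for n w
      by (simp add: g'_def s funpow_Suc_right del: funpow.simps)
    have "\<forall>n. g' n \<in> range (\<lambda>n. f ^^ n)" unfolding g'_def by blast
    note normal = U(3)[unfolded normal_family_def, THEN spec, THEN mp, OF this]
    then obtain r where r: "strict_mono r" and
      alt: "(\<exists>h. \<forall>K. compact K \<and> K \<subseteq> U \<longrightarrow> uniform_limit K (\<lambda>n. g' (r n)) h sequentially)
            \<or> (\<forall>K. compact K \<and> K \<subseteq> U \<longrightarrow>
                 (\<forall>B::real. eventually (\<lambda>n. \<forall>z\<in>K. B \<le> norm (g' (r n) z)) sequentially))"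
      using normal by blast
    \<comment> \<open>All subsets of V are covered by the image of one compact disc in U, so the
      behaviour on that disc decides both alternatives.\<close>
    have sub: "\<forall>y\<in>K. \<exists>w\<in>cball z \<rho>. y = f w" if "K \<subseteq> V" for K
      using that by (force simp: V_def)
    have "(\<exists>h. \<forall>K. compact K \<and> K \<subseteq> V \<longrightarrow> uniform_limit K (\<lambda>n. g (r n)) h sequentially)
            \<or> (\<forall>K. compact K \<and> K \<subseteq> V \<longrightarrow>
                 (\<forall>B::real. eventually (\<lambda>n. \<forall>z\<in>K. B \<le> norm (g (r n) z)) sequentially))"
      using alt
    proof
      assume "\<exists>h. \<forall>K. compact K \<and> K \<subseteq> U \<longrightarrow> uniform_limit K (\<lambda>n. g' (r n)) h sequentially"
      then obtain h where h: "uniform_limit (cball z \<rho>) (\<lambda>n. g' (r n)) h sequentially"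
        using \<rho>(2) compact_cball by blast
      \<comment> \<open>Defined as a pointwise limit, the limit on V does not depend on which
        preimage w is used.\<close>
      define h' where "h' y = lim (\<lambda>n. g (r n) y)" for y
      have h'_eq: "h' (f w) = h w" if "w \<in> cball z \<rho>" for w
        unfolding h'_def
        using tendsto_uniform_limitI[OF h that] by (simp add: g' limI)
      have "uniform_limit K (\<lambda>n. g (r n)) h' sequentially" if KV: "K \<subseteq> V" for K
      proof (rule uniform_limitI)
        fix e :: real assume "e > 0"
        from uniform_limitD[OF h this]
        show "\<forall>\<^sub>F n in sequentially. \<forall>y\<in>K. dist (g (r n) y) (h' y) < e"
        proof eventually_elim
          case (elim n)
          show ?case
          proof
            fix y assume "y \<in> K"
            then obtain w where "w \<in> cball z \<rho>" "y = f w" using sub[OF KV] by blast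
            then show "dist (g (r n) y) (h' y) < e" using elim h'_eq by (simp add: g')
          qed
        qed
      qed
      then show ?thesis by blast
    next
      assume *: "\<forall>K. compact K \<and> K \<subseteq> U \<longrightarrow>
                 (\<forall>B::real. eventually (\<lambda>n. \<forall>z\<in>K. B \<le> norm (g' (r n) z)) sequentially)"
      have "\<forall>\<^sub>F n in sequentially. \<forall>y\<in>K. B \<le> norm (g (r n) y)" if KV: "K \<subseteq> V" for K B
      proof -
        have "\<forall>\<^sub>F n in sequentially. \<forall>w\<in>cball z \<rho>. B \<le> norm (g' (r n) w)"
          using *[rule_format, of "cball z \<rho>" B] \<rho> by simp
        then show ?thesis
        proof eventually_elim
          case (elim n)
          show ?case
          proof
            fix y assume "y \<in> K"
            then obtain w where "w \<in> cball z \<rho>" "y = f w" using sub[OF KV] by blast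
            then show "B \<le> norm (g (r n) y)" using elim by (simp add: g')
          qed
        qed
      qed
      then show ?thesis by blast
    qed
    then show "\<exists>r. strict_mono r \<and> ((\<exists>h. \<forall>K. compact K \<and> K \<subseteq> V \<longrightarrow> uniform_limit K (\<lambda>n. g (r n)) h sequentially)
            \<or> (\<forall>K. compact K \<and> K \<subseteq> V \<longrightarrow>
                 (\<forall>B::real. eventually (\<lambda>n. \<forall>z\<in>K. B \<le> norm (g (r n) z)) sequentially)))"
      using r by blast
  qed
  ultimately show ?thesis by (auto simp: fatou_set_def)
qed

lemma funpow_f_in_F: "z \<in> F \<Longrightarrow> (f ^^ n) z \<in> F"
  by (induction n) (auto intro: f_in_F)

lemma zero_orbit_notin_F:
  assumes "(f ^^ n) z = 0"
  shows "z \<notin> F"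
  using funpow_f_in_F[of z n] zero_notin_F assms by auto

lemma no_ball_7_in_F: "\<not> ball b 7 \<subseteq> F"
proof -
  obtain y where "y \<in> ball b 7" "(f ^^ 2) y = 0"
    using ball_7_contains_zero_of_f2[of b] by (auto simp: numeral_2_eq_2)
  then show ?thesis using zero_orbit_notin_F by blast
qed

end

section \<open>The attracting petal reaches a critical value\<close>

context parabolic_sine
begin

lemma iterates_bounded_on_compact:
  assumes "compact K"
  obtains B where "\<And>i z. i < N \<Longrightarrow> z \<in> K \<Longrightarrow> norm ((f ^^ i) z) \<le> B"
proof -
  have "compact (\<Union>i<N. (f ^^ i) ` K)"
    by (intro compact_UN compact_continuous_image funpow_f_continuous assms) auto
  then have "bounded (\<Union>i<N. (f ^^ i) ` K)" by (rule compact_imp_bounded)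
  then obtain B where "\<forall>y\<in>(\<Union>i<N. (f ^^ i) ` K). norm y \<le> B"
    unfolding bounded_iff by blast
  then show ?thesis by (intro that[of B]) blast
qed

text \<open>In the coordinate \<open>w = - 1 / (k a z ^ k)\<close> on an attracting sector, the map
  \<open>f ^^ Q\<close> becomes a perturbation of \<open>w \<mapsto> w + 1\<close>.\<close>

lemma attracting_petal:
  obtains C \<zeta> T \<zeta>' \<sigma> \<epsilon> where
    "\<zeta> holomorphic_on {w. Re w > C}" "T holomorphic_on {w. Re w > C}"
    "\<And>w. Re w > C \<Longrightarrow> \<zeta> w \<noteq> 0"
    "\<And>w. Re w > C \<Longrightarrow> norm (\<zeta> w) < \<epsilon>"
    "\<And>w. Re w > C \<Longrightarrow> (\<zeta> has_field_derivative \<zeta>' w) (at w)"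
    "\<And>w. Re w > C \<Longrightarrow> \<zeta>' w \<noteq> 0"
    "\<And>w. Re w > C \<Longrightarrow> norm (T w - w - 1) \<le> 1 / 4"
    "\<And>w. Re w > C \<Longrightarrow> (f ^^ Q) (\<zeta> w) = \<zeta> (T w)"
    "path \<sigma>" "\<sigma> 0 = 0" "\<sigma> 1 = \<zeta> (of_real (C + 1))"
    "\<And>s. 0 < s \<Longrightarrow> s \<le> 1 \<Longrightarrow> \<exists>w. Re w > C \<and> \<sigma> s = \<zeta> w"
proof -
  obtain k G where k: "k \<ge> 1" and holG: "G holomorphic_on UNIV" and G0: "G 0 \<noteq> 0"
    and expand: "\<And>z. (f ^^ Q) z = z + z ^ Suc k * G z"
    using parabolic_expansion by metis
  define a where "a = G 0"
  have a: "a \<noteq> 0" using G0 by (simp add: a_def)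
  define E where "E z = 1 + z ^ k * G z" for z
  \<comment> \<open>In the coordinate w the map f^Q is w / E^k, which equals w +
    \<open>\<Phi> z\<close>. Written without division by z, the increment is continuous at 0, with
    value 1.\<close>
  define \<Phi> where "\<Phi> z = G z * (\<Sum>i<k. E z ^ i) / (of_nat k * a * E z ^ k)" for z
  have fQ: "(f ^^ Q) z = z * E z" for z
    by (simp add: expand E_def algebra_simps)
  have holE: "E holomorphic_on S" for S
    unfolding E_def by (intro holomorphic_intros holomorphic_on_subset[OF holG]) auto
  have E0: "E 0 = 1" using k by (simp add: E_def)
  have contE: "isCont E 0"
    using holomorphic_on_imp_continuous_on[OF holE[of UNIV]] by (simp add: continuous_on_eq_continuous_at)
  have contG: "isCont G 0"
    using holomorphic_on_imp_continuous_on[OF holG] by (simp add: continuous_on_eq_continuous_at)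
  have "isCont \<Phi> 0"
    unfolding \<Phi>_def by (intro continuous_intros contE contG) (use k a E0 in auto)
  then have "(\<Phi> \<longlongrightarrow> \<Phi> 0) (at 0)" by (simp add: isCont_def)
  then have lim\<Phi>: "(\<Phi> \<longlongrightarrow> 1) (at 0)" using k a by (simp add: \<Phi>_def E0 a_def)
  have limE: "(E \<longlongrightarrow> 1) (at 0)" using contE E0 by (simp add: isCont_def)
  have "((\<lambda>z. Ln (E z)) \<longlongrightarrow> Ln 1) (at 0)"
    by (intro tendsto_intros limE) auto
  then have limL: "((\<lambda>z. Ln (E z)) \<longlongrightarrow> 0) (at 0)" by simp
  \<comment> \<open>The bound 1 / k keeps the imaginary part of k Ln (E z) below 1, for the choice
    of logarithm in the conjugacy.\<close>
  have "\<forall>\<^sub>F z in at 0. dist (\<Phi> z) 1 < 1 / 4 \<and> dist (E z) 1 < 1 \<and> dist (Ln (E z)) 0 < 1 / k"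
    using k by (intro eventually_conj tendstoD lim\<Phi> limE limL) auto
  then obtain \<epsilon> where \<epsilon>: "\<epsilon> > 0" and near: "\<And>z. z \<noteq> 0 \<Longrightarrow> norm z < \<epsilon> \<Longrightarrow>
      dist (\<Phi> z) 1 < 1 / 4 \<and> dist (E z) 1 < 1 \<and> dist (Ln (E z)) 0 < 1 / k"
    unfolding eventually_at by (auto simp: dist_norm)
  have E_nz: "E z \<noteq> 0" if "norm z < \<epsilon>" for z
    using near[of z] that E0 by (cases "z = 0") (auto simp: dist_norm)
  \<comment> \<open>A k-th root of -1 / (k a), so that \<open>\<zeta> w\<close> =
    \<open>\<mu>\<close> w^(-1/k) inverts the coordinate.\<close>
  define \<mu> where "\<mu> = exp (Ln (- 1 / (of_nat k * a)) / of_nat k)"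
  have \<mu>: "\<mu> ^ k = - 1 / (of_nat k * a)" "\<mu> \<noteq> 0"
    using k a by (simp_all add: \<mu>_def flip: exp_of_nat_mult)
  define \<zeta> where "\<zeta> w = \<mu> * exp (- Ln w / of_nat k)" for w
  have \<zeta>_pow: "\<zeta> w ^ k = - 1 / (of_nat k * a * w)" if "w \<noteq> 0" for w
  proof -
    have "exp (- Ln w / of_nat k) ^ k = exp (- Ln w)"
      using k by (simp flip: exp_of_nat_mult)
    then show ?thesis using that a k by (simp add: \<zeta>_def power_mult_distrib \<mu> exp_minus field_simps)
  qed
  \<comment> \<open>Makes |\<open>\<zeta> w\<close>|^k = 1 / (k |a| |w|) smaller than
    \<open>\<epsilon> ^ k\<close>; the 1 keeps the half-plane off the cut of
    \<open>Ln\<close>.\<close>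
  define C where "C = max 1 (1 / (k * norm a * \<epsilon> ^ k))"
  have C: "C \<ge> 1" by (simp add: C_def)
  have nz: "w \<noteq> 0" "w \<notin> \<real>\<^sub>\<le>\<^sub>0" "Re w > 0" if "Re w > C" for w
    using that C by (auto simp: complex_nonpos_Reals_iff)
  have small: "norm (\<zeta> w) < \<epsilon>" if "Re w > C" for w
  proof (rule power_less_imp_less_base)
    have ka: "k * norm a * \<epsilon> ^ k > 0" using k a \<epsilon> by simp
    have "1 / (k * norm a * \<epsilon> ^ k) < norm w"
      using that complex_Re_le_cmod[of w] by (simp add: C_def)
    then have "1 < norm w * (k * norm a * \<epsilon> ^ k)" using ka by (simp add: divide_less_eq)
    then have "1 / (k * norm a * norm w) < \<epsilon> ^ k"
      using k a nz[OF that] by (simp add: divide_less_eq mult_ac)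
    then show "norm (\<zeta> w) ^ k < \<epsilon> ^ k"
      using \<zeta>_pow[OF nz(1)[OF that]] by (simp add: norm_divide norm_mult flip: norm_power)
  qed (use \<epsilon> in auto)
  have \<zeta>_nz: "\<zeta> w \<noteq> 0" for w using \<mu> by (simp add: \<zeta>_def)
  define \<zeta>' where "\<zeta>' w = \<zeta> w * (- (1 / w) / of_nat k)" for w
  have der: "(\<zeta> has_field_derivative \<zeta>' w) (at w)" if "Re w > C" for w
    unfolding \<zeta>_def \<zeta>'_def using nz[OF that] k
    by (auto intro!: derivative_eq_intros simp: field_simps)
  have der_nz: "\<zeta>' w \<noteq> 0" if "Re w > C" for w
    using nz[OF that] k \<zeta>_nz by (simp add: \<zeta>'_def)
  have hol\<zeta>: "\<zeta> holomorphic_on {w. Re w > C}"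
    unfolding holomorphic_on_def field_differentiable_def
    using der has_field_derivative_at_within by blast
  define T where "T w = w + \<Phi> (\<zeta> w)" for w
  have "\<Phi> holomorphic_on ball 0 \<epsilon>"
    unfolding \<Phi>_def
    by (intro holomorphic_intros holomorphic_on_subset[OF holG] holE) (use E_nz k a in auto)
  then have "(\<Phi> \<circ> \<zeta>) holomorphic_on {w. Re w > C}"
    by (rule holomorphic_on_compose_gen[OF hol\<zeta>]) (use small in auto)
  then have holT: "T holomorphic_on {w. Re w > C}"
    unfolding T_def by (intro holomorphic_intros) (simp add: o_def)
  have T: "norm (T w - w - 1) \<le> 1 / 4" if "Re w > C" for w
    using near[OF \<zeta>_nz small[OF that]] by (simp add: T_def dist_norm)
  have conj: "(f ^^ Q) (\<zeta> w) = \<zeta> (T w)" if w: "Re w > C" for w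
  proof -
    define z where "z = \<zeta> w"
    have z: "norm z < \<epsilon>" "z \<noteq> 0" using small[OF w] \<zeta>_nz by (auto simp: z_def)
    have Ez: "E z \<noteq> 0" by (rule E_nz) (rule z)
    have "of_nat k * a * z ^ k * \<Phi> z = (E z ^ k - 1) / E z ^ k"
    proof -
      have "E z ^ k - 1 = z ^ k * G z * (\<Sum>i<k. E z ^ i)"
        using power_diff_1_eq[of "E z" k] by (simp add: E_def)
      then show ?thesis using k a by (simp add: \<Phi>_def)
    qed
    moreover have "of_nat k * a * z ^ k = - 1 / w"
      using \<zeta>_pow[OF nz(1)[OF w]] k a by (simp add: z_def)
    ultimately have "- 1 / w * \<Phi> z = (E z ^ k - 1) / E z ^ k" by simp
    moreover have "\<Phi> z = - w * (- 1 / w * \<Phi> z)" using nz(1)[OF w] by simp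
    ultimately have "\<Phi> z = - w * ((E z ^ k - 1) / E z ^ k)" by simp
    also have "\<dots> = w / E z ^ k - w" using Ez by (simp add: field_simps)
    finally have Tw: "T w = w / E z ^ k" unfolding T_def z_def[symmetric] by simp
    \<comment> \<open>Both sides agree up to a multiple of 2 pi i, and the bound pi/2 + 1 < pi for
      the imaginary part selects the principal branch.\<close>
    have "Ln (T w) = Ln w - of_nat k * Ln (E z)"
    proof (rule Ln_unique)
      show "exp (Ln w - of_nat k * Ln (E z)) = T w"
        using Ez nz(1)[OF w] by (simp add: exp_diff exp_of_nat_mult Tw)
      have "\<bar>Im (of_nat k * Ln (E z))\<bar> \<le> norm (of_nat k * Ln (E z))" by (rule abs_Im_le_cmod)
      also have "\<dots> < 1" using near[OF z(2,1)] k by (simp add: norm_mult field_simps)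
      finally have "\<bar>Im (of_nat k * Ln (E z))\<bar> < 1" .
      moreover have "\<bar>Im (Ln w)\<bar> < pi / 2" using Re_Ln_pos_lt[OF nz(1)[OF w]] nz(3)[OF w] by simp
      ultimately show "- pi < Im (Ln w - of_nat k * Ln (E z))" "Im (Ln w - of_nat k * Ln (E z)) \<le> pi"
        using pi_gt3 by (simp_all add: abs_if split: if_splits)
    qed
    then have "- Ln (T w) / of_nat k = - Ln w / of_nat k + Ln (E z)"
      using k by (simp add: field_simps)
    then have "exp (- Ln (T w) / of_nat k) = exp (- Ln w / of_nat k) * E z"
      using exp_add[of "- Ln w / of_nat k" "Ln (E z)"] Ez by simp
    then have "\<zeta> (T w) = z * E z"
      unfolding \<zeta>_def z_def by simp
    then show ?thesis by (simp add: fQ z_def)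
  qed
  \<comment> \<open>The image under \<open>\<zeta>\<close> of the real ray from infinity to C + 1,
    written as a power of s so that it is continuous at s = 0.\<close>
  define \<sigma> where "\<sigma> s = \<mu> * of_real ((s / (C + 1)) powr (1 / k))" for s :: real
  have "path \<sigma>"
    unfolding path_def \<sigma>_def using C k
    by (intro continuous_intros continuous_on_powr') auto
  moreover have \<sigma>_eq: "\<sigma> s = \<zeta> (of_real ((C + 1) / s))" if "s > 0" for s
  proof -
    have pos: "(C + 1) / s > 0" using that C by simp
    have "ln ((C + 1) / s) = - ln (s / (C + 1))"
      using that C by (simp add: ln_div)
    then have "exp (- Ln (of_real ((C + 1) / s)) / of_nat k) =
        (exp (of_real (1 / k * ln (s / (C + 1)))) :: complex)"
      unfolding Ln_of_real[OF pos] by simp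
    also have "\<dots> = of_real ((s / (C + 1)) powr (1 / k))"
      using that C unfolding powr_def exp_of_real by simp
    finally show ?thesis unfolding \<zeta>_def \<sigma>_def by simp
  qed
  moreover have "\<exists>w. Re w > C \<and> \<sigma> s = \<zeta> w" if "0 < s" "s \<le> 1" for s
  proof (intro exI conjI)
    show "\<sigma> s = \<zeta> (of_real ((C + 1) / s))" by (rule \<sigma>_eq) (rule that)
    have "C * s \<le> C * 1" using that C by (intro mult_left_mono) auto
    then show "Re (complex_of_real ((C + 1) / s)) > C"
      using that by (simp only: Re_complex_of_real less_divide_eq) auto
  qed
  moreover have "\<sigma> 0 = 0" using k by (simp add: \<sigma>_def)
  moreover have "\<sigma> 1 = \<zeta> (of_real (C + 1))" using \<sigma>_eq[of 1] by simp
  ultimately show ?thesis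
    by (intro that[of \<zeta> C T \<epsilon> \<zeta>' \<sigma>] hol\<zeta> holT \<zeta>_nz small der der_nz T conj) auto
qed


text \<open>Bloch's theorem for a full inverse branch around \<open>w n\<close> would give a disc of
  radius 7 in which f^N has no zero, since \<open>\<zeta>\<close> omits 0. Hence a partial lift
  meets a critical value; the path follows a forward image of the petal ray and then this
  lift.\<close>

lemma bounded_path_to_critical_value:
  obtains \<psi> B where "path \<psi>" "\<psi> 0 = 0" "\<psi> 1 = lam \<or> \<psi> 1 = - lam"
    "\<And>n z. z \<in> path_image \<psi> \<Longrightarrow> norm ((f ^^ n) z) \<le> B"
proof -
  obtain C \<zeta> T \<zeta>' \<sigma> \<epsilon> where
    hol\<zeta>: "\<zeta> holomorphic_on {w. Re w > C}" and holT: "T holomorphic_on {w. Re w > C}" and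
    \<zeta>_nz: "\<And>w. Re w > C \<Longrightarrow> \<zeta> w \<noteq> 0" and
    small: "\<And>w. Re w > C \<Longrightarrow> norm (\<zeta> w) < \<epsilon>" and
    der: "\<And>w. Re w > C \<Longrightarrow> (\<zeta> has_field_derivative \<zeta>' w) (at w)" and
    der_nz: "\<And>w. Re w > C \<Longrightarrow> \<zeta>' w \<noteq> 0" and
    T: "\<And>w. Re w > C \<Longrightarrow> norm (T w - w - 1) \<le> 1 / 4" and
    conj: "\<And>w. Re w > C \<Longrightarrow> (f ^^ Q) (\<zeta> w) = \<zeta> (T w)" and
    \<sigma>: "path \<sigma>" "\<sigma> 0 = 0" "\<sigma> 1 = \<zeta> (of_real (C + 1))"
      "\<And>s. 0 < s \<Longrightarrow> s \<le> 1 \<Longrightarrow> \<exists>w. Re w > C \<and> \<sigma> s = \<zeta> w"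
    by (rule attracting_petal, rule that)
  define H where "H = {w. Re w > C}"
  have H: "open H" "convex H"
    unfolding H_def using open_halfspace_Re_gt convex_halfspace_Re_gt by auto
  define w0 :: complex where "w0 = of_real (C + 1)"
  define w where "w n = (T ^^ n) w0" for n
  have T_Re: "Re (T v) \<ge> Re v + 3 / 4" if "Re v > C" for v
    using T[OF that] abs_Re_le_cmod[of "T v - v - 1"] by simp
  have T_pow: "Re ((T ^^ n) v) > C" if "Re v > C" for n v
  proof (induction n)
    case (Suc n)
    show ?case using T_Re[OF Suc] Suc by simp
  qed (use that in auto)
  have Re_w: "Re (w n) \<ge> C + 1 + 3 / 4 * n" for n
  proof (induction n)
    case (Suc n)
    then have "Re (w n) > C" by (rule less_le_trans[rotated]) auto
    from T_Re[OF this] have "Re (w (Suc n)) \<ge> Re (w n) + 3 / 4" by (simp add: w_def)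
    moreover have "3 / 4 * real (Suc n) = 3 / 4 * n + 3 / 4" by simp
    ultimately show ?case using Suc by linarith
  qed (simp add: w_def w0_def)
  have w_H: "Re (w n) > C" for n by (rule less_le_trans[OF _ Re_w]) auto
  have ball_H: "cball (w n) (3 / 4 * (real n + 1)) \<subseteq> H" for n
  proof
    fix v assume "v \<in> cball (w n) (3 / 4 * (real n + 1))"
    then have "\<bar>Re (w n - v)\<bar> \<le> 3 / 4 * (real n + 1)"
      using abs_Re_le_cmod[of "w n - v"] by (simp add: dist_norm)
    then show "v \<in> H" using Re_w[of n] by (simp add: H_def abs_if algebra_simps split: if_splits)
  qed
  have conj_pow: "(f ^^ (Q * n)) (\<zeta> v) = \<zeta> ((T ^^ n) v)" if "Re v > C" for n v
  proof (induction n)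
    case (Suc n)
    have "(f ^^ (Q * Suc n)) (\<zeta> v) = (f ^^ Q) ((f ^^ (Q * n)) (\<zeta> v))"
      by (simp add: funpow_add)
    then show ?case using Suc conj[OF T_pow[OF that]] by simp
  qed simp
  have T_der: "(T has_field_derivative deriv T v) (at v)" if "Re v > C" for v
    using holT that H(1) by (intro holomorphic_derivI) (auto simp: H_def)
  \<comment> \<open>Cauchy's estimate for T - id - 1, which is at most 1/4 on the disc of radius 3/4
    (n + 1) about \<open>w n\<close>.\<close>
  have T_der_bound: "norm (deriv T (w n)) \<le> 1 + 1 / (3 * (real n + 1))" for n
  proof -
    define g where "g v = T v - v - 1" for v
    have "norm ((deriv ^^ 1) g (w n)) \<le> fact 1 * (1 / 4) / (3 / 4 * (real n + 1)) ^ 1"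
    proof (rule Cauchy_inequality)
      have hol: "g holomorphic_on cball (w n) (3 / 4 * (real n + 1))"
        unfolding g_def using ball_H[of n]
        by (intro holomorphic_intros holomorphic_on_subset[OF holT]) (auto simp: H_def)
      then show "continuous_on (cball (w n) (3 / 4 * (real n + 1))) g"
        by (rule holomorphic_on_imp_continuous_on)
      show "g holomorphic_on ball (w n) (3 / 4 * (real n + 1))"
        using hol by (rule holomorphic_on_subset) auto
    next
      fix v assume "norm (w n - v) = 3 / 4 * (real n + 1)"
      then have "v \<in> H" using ball_H[of n] by (auto simp: dist_norm)
      then show "norm (g v) \<le> 1 / 4" using T by (simp add: H_def g_def)
    qed simp
    moreover have "deriv g (w n) = deriv T (w n) - 1"
      unfolding g_def
      by (rule DERIV_imp_deriv) (use T_der[OF w_H] in \<open>auto intro!: derivative_eq_intros\<close>)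
    ultimately have "norm (deriv T (w n) - 1) \<le> 1 / (3 * (real n + 1))" by (simp add: field_simps)
    then show ?thesis using norm_triangle_sub[of "deriv T (w n)" 1] by simp
  qed
  \<comment> \<open>The derivative of T^n grows at most like sqrt (n + 1), slower than the radius
    3/4 (n + 1). Squaring lets the induction close: (1 + 1 / (3 m))^2 m <= m + 1.\<close>
  have "\<exists>D. ((T ^^ n) has_field_derivative D) (at w0) \<and> norm D ^ 2 \<le> real n + 1" for n
  proof (induction n)
    case 0
    show ?case by (intro exI[of _ 1]) (simp add: id_def)
  next
    case (Suc n)
    then obtain D where D: "((T ^^ n) has_field_derivative D) (at w0)" "norm D ^ 2 \<le> real n + 1"
      by blast
    have "(T has_field_derivative deriv T (w n)) (at ((T ^^ n) w0))"
      using T_der[OF w_H[of n]] by (simp add: w_def)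
    from DERIV_chain[OF this D(1)]
    have "((T ^^ Suc n) has_field_derivative deriv T (w n) * D) (at w0)" by (simp add: o_def)
    moreover have "norm (deriv T (w n) * D) ^ 2 \<le> real (Suc n) + 1"
    proof -
      define m :: real where "m = real n + 1"
      have m: "m \<ge> 1" by (simp add: m_def)
      have "norm (deriv T (w n) * D) ^ 2 = norm (deriv T (w n)) ^ 2 * norm D ^ 2"
        by (simp add: norm_mult power_mult_distrib)
      also have "\<dots> \<le> (1 + 1 / (3 * m)) ^ 2 * m"
        using T_der_bound[of n] D(2) by (intro mult_mono power_mono) (auto simp: m_def)
      also have "\<dots> = m + 2 / 3 + 1 / (9 * m)" using m by (simp add: power2_eq_square field_simps)
      also have "\<dots> \<le> m + 1" using m by (simp add: field_simps)
      finally show ?thesis by (simp add: m_def)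
    qed
    ultimately show ?case by blast
  qed
  then obtain D where D: "\<And>n. ((T ^^ n) has_field_derivative D n) (at w0)"
      "\<And>n. norm (D n) ^ 2 \<le> real n + 1"
    by metis
  have w0_H: "Re w0 > C" by (simp add: w0_def)
  define d where "d = norm (\<zeta>' w0)"
  have d: "d > 0" using der_nz[OF w0_H] by (simp add: d_def)
  \<comment> \<open>112 = 7 * 12 * 4/3: the Bloch disc has radius 3/4 (n + 1) |G'| / 12, where |G'|
    >= d / sqrt (n + 1).\<close>
  define n where "n = nat \<lceil>(112 / d) ^ 2\<rceil> + 2"
  have n: "n \<ge> 2" "(112 / d) ^ 2 \<le> n" unfolding n_def by linarith+
  define N where "N = Q * n"
  have N: "N \<ge> 2" using Q_pos n(1) unfolding N_def
    by (metis One_nat_def Suc_leI le_trans mult_1 mult_le_mono1)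
  define x where "x = \<zeta> w0"
  have base: "(f ^^ N) x = \<zeta> (w n)"
    using conj_pow[OF w0_H] by (simp add: N_def x_def w_def)
  have "\<exists>j G. j < N \<and> G holomorphic_on H \<and> G (w n) = (f ^^ (N - j)) x \<and>
        (\<forall>v\<in>H. (f ^^ j) (G v) = \<zeta> v) \<and> (lam \<in> G ` H \<or> - lam \<in> G ` H)"
  proof (rule iterated_lift[of \<zeta> H "w n" N x])
    fix G assume G: "G holomorphic_on H" "G (w n) = x" "\<And>v. v \<in> H \<Longrightarrow> (f ^^ N) (G v) = \<zeta> v"
    define A where "A = deriv (f ^^ N) x"
    have A: "((f ^^ N) has_field_derivative A) (at x)"
      unfolding A_def by (rule holomorphic_derivI[OF funpow_f_holomorphic open_UNIV]) simp
    have wH: "w n \<in> H" using w_H by (simp add: H_def)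
    have derG: "(G has_field_derivative deriv G (w n)) (at (w n))"
      using G(1) H(1) wH by (rule holomorphic_derivI)
    have "((f ^^ N) \<circ> G has_field_derivative A * deriv G (w n)) (at (w n))"
      by (rule DERIV_chain[OF _ derG]) (use A G(2) in simp)
    then have "(\<zeta> has_field_derivative A * deriv G (w n)) (at (w n))"
      by (rule has_field_derivative_transform_within_open[OF _ H(1) wH]) (use G(3) in auto)
    from DERIV_unique[OF this der[OF w_H]] have eq1: "A * deriv G (w n) = \<zeta>' (w n)" .
    have "((f ^^ N) \<circ> \<zeta> has_field_derivative A * \<zeta>' w0) (at w0)"
      by (rule DERIV_chain[OF _ der[OF w0_H]]) (use A in \<open>simp add: x_def\<close>)
    moreover have "(\<zeta> \<circ> (T ^^ n) has_field_derivative \<zeta>' (w n) * D n) (at w0)"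
      by (rule DERIV_chain[OF _ D(1)]) (use der[OF w_H] in \<open>simp add: w_def\<close>)
    then have "((f ^^ N) \<circ> \<zeta> has_field_derivative \<zeta>' (w n) * D n) (at w0)"
      by (rule has_field_derivative_transform_within_open[OF _ H(1)])
        (use w0_H conj_pow in \<open>auto simp: H_def N_def\<close>)
    ultimately have eq2: "A * \<zeta>' w0 = \<zeta>' (w n) * D n" by (rule DERIV_unique)
    have "A \<noteq> 0" using eq1 der_nz[OF w_H[of n]] by auto
    \<comment> \<open>The chain rule for f^N o G = \<open>\<zeta>\<close> and f^N o
      \<open>\<zeta>\<close> = \<open>\<zeta>\<close> o T^n, with the common factor A
      cancelled.\<close>
    then have "deriv G (w n) * D n = \<zeta>' w0"
      using eq1 eq2 by (metis mult.assoc mult_left_cancel)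
    then have "d ^ 2 = norm (deriv G (w n)) ^ 2 * norm (D n) ^ 2"
      by (metis d_def norm_mult power_mult_distrib)
    also have "\<dots> \<le> norm (deriv G (w n)) ^ 2 * (real n + 1)"
      by (intro mult_left_mono D) auto
    finally have d_le: "d ^ 2 \<le> norm (deriv G (w n)) ^ 2 * (real n + 1)" .
    have "(112::real) ^ 2 \<le> d ^ 2 * n" using n(2) d by (simp add: power_divide field_simps)
    also have "\<dots> \<le> d ^ 2 * (real n + 1)" by (intro mult_left_mono) auto
    also have "\<dots> \<le> (norm (deriv G (w n)) ^ 2 * (real n + 1)) * (real n + 1)"
      by (intro mult_right_mono d_le) auto
    also have "\<dots> = (norm (deriv G (w n)) * (real n + 1)) ^ 2" by (simp add: power2_eq_square)
    finally have "112 \<le> norm (deriv G (w n)) * (real n + 1)"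
      by (rule power2_le_imp_le) auto
    then have r: "7 \<le> 3 / 4 * (real n + 1) * norm (deriv G (w n)) / 12" by (simp add: algebra_simps)
    obtain b where b: "ball b 7 \<subseteq> G ` ball (w n) (3 / 4 * (real n + 1))"
    proof (rule Bloch[OF _ _ r])
      show "G holomorphic_on ball (w n) (3 / 4 * (real n + 1))"
        using ball_H[of n] ball_subset_cball by (blast intro: holomorphic_on_subset[OF G(1)])
    qed auto
    obtain y where y: "y \<in> ball b 7" "f (f y) = 0" by (rule ball_7_contains_zero_of_f2)
    then obtain v where v: "v \<in> H" "y = G v"
      using b ball_H[of n] ball_subset_cball by blast
    have "(f ^^ N) y = (f ^^ (N - 2)) ((f ^^ 2) y)"
      using N by (metis comp_apply funpow_add le_add_diff_inverse2)
    also have "(f ^^ 2) y = 0" using y by (simp add: numeral_2_eq_2)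
    finally have "\<zeta> v = 0" using G(3)[OF v(1)] v by simp
    then show ?thesis using \<zeta>_nz v(1) by (auto simp: H_def)
  next
    fix j G assume "j < N" "G holomorphic_on H" "G (w n) = (f ^^ (N - j)) x"
      "\<And>v. v \<in> H \<Longrightarrow> (f ^^ j) (G v) = \<zeta> v" "lam \<in> G ` H \<or> - lam \<in> G ` H"
    then show ?thesis by blast
  qed (use hol\<zeta> H(2) base w_H in \<open>auto simp: H_def convex_imp_contractible\<close>)
  then obtain j G where j: "j < N" and holG: "G holomorphic_on H" and Gw: "G (w n) = (f ^^ (N - j)) x"
    and fG: "\<And>v. v \<in> H \<Longrightarrow> (f ^^ j) (G v) = \<zeta> v" and crit: "lam \<in> G ` H \<or> - lam \<in> G ` H"
    by blast
  \<comment> \<open>Orbits from the petal lie in the disc of radius \<open>\<epsilon>\<close> at all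
    multiples of Q, so bounding the first Q iterates on that disc suffices.\<close>
  obtain B1 where B1: "\<And>i z. i < Q \<Longrightarrow> z \<in> cball 0 \<epsilon> \<Longrightarrow> norm ((f ^^ i) z) \<le> B1"
    using iterates_bounded_on_compact[of "cball 0 \<epsilon>" Q] by auto
  have orbit_\<zeta>: "norm ((f ^^ m) (\<zeta> v)) \<le> B1" if "Re v > C" for m v
  proof -
    have "(f ^^ m) (\<zeta> v) = (f ^^ (m mod Q + Q * (m div Q))) (\<zeta> v)" by simp
    also have "\<dots> = (f ^^ (m mod Q)) (\<zeta> ((T ^^ (m div Q)) v))"
      unfolding funpow_add comp_def conj_pow[OF that] ..
    also have "norm \<dots> \<le> B1"
      using small[OF T_pow[OF that]] Q_pos by (intro B1) (auto intro: less_imp_le)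
    finally show ?thesis .
  qed
  obtain p where p: "p \<in> H" "G p = lam \<or> G p = - lam" using crit by auto
  \<comment> \<open>\<open>\<sigma>\<close> ends at x and G sends \<open>w n\<close> to f^(N-j) x,
    so the two pieces join there.\<close>
  define \<psi>0 where "\<psi>0 = (f ^^ (N - j)) \<circ> \<sigma>"
  define \<psi>1 where "\<psi>1 = G \<circ> linepath (w n) p"
  have seg: "closed_segment (w n) p \<subseteq> H"
    using p(1) w_H H(2) by (intro closed_segment_subset) (auto simp: H_def)
  have "path \<psi>0" unfolding \<psi>0_def
    by (rule path_continuous_image[OF \<sigma>(1) funpow_f_continuous])
  have "path \<psi>1" unfolding \<psi>1_def
    by (rule path_continuous_image[OF path_linepath])
      (use seg holG in \<open>auto intro: continuous_on_subset holomorphic_on_imp_continuous_on\<close>)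
  have join: "pathfinish \<psi>0 = pathstart \<psi>1"
    using \<sigma>(3) Gw by (simp add: \<psi>0_def \<psi>1_def pathfinish_def pathstart_def linepath_def x_def w0_def)
  have B1_nonneg: "0 \<le> B1" using orbit_\<zeta>[OF w0_H] norm_ge_zero order_trans by blast
  obtain B2 where B2: "\<And>i z. i < j \<Longrightarrow> z \<in> path_image \<psi>1 \<Longrightarrow> norm ((f ^^ i) z) \<le> B2"
    using iterates_bounded_on_compact[OF compact_path_image[OF \<open>path \<psi>1\<close>], of j] by blast
  have bound0: "norm ((f ^^ m) z) \<le> B1" if z: "z \<in> path_image \<psi>0" for m z
  proof -
    obtain s where s: "0 \<le> s" "s \<le> 1" "z = (f ^^ (N - j)) (\<sigma> s)"
      using z by (auto simp: path_image_def \<psi>0_def)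
    show ?thesis
    proof (cases "s = 0")
      case True
      then show ?thesis using s \<sigma>(2) B1_nonneg by simp
    next
      case False
      then obtain v where "Re v > C" "\<sigma> s = \<zeta> v" using \<sigma>(4)[of s] s by auto
      then show ?thesis using orbit_\<zeta>[of v "m + (N - j)"] s(3) by (simp add: funpow_add)
    qed
  qed
  have bound1: "norm ((f ^^ m) z) \<le> max B1 B2" if z: "z \<in> path_image \<psi>1" for m z
  proof (cases "m < j")
    case True
    then show ?thesis using B2[OF _ z] by (simp add: le_max_iff_disj)
  next
    case False
    obtain v where v: "v \<in> H" "z = G v"
      using z seg by (auto simp: \<psi>1_def path_image_compose)
    have "(f ^^ m) z = (f ^^ (m - j)) ((f ^^ j) z)"
      using False by (metis comp_apply funpow_add le_add_diff_inverse2 not_less)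
    also have "\<dots> = (f ^^ (m - j)) (\<zeta> v)" using fG v by simp
    finally show ?thesis using orbit_\<zeta>[of v "m - j"] v by (simp add: H_def le_max_iff_disj)
  qed
  show ?thesis
  proof (rule that[of "\<psi>0 +++ \<psi>1" "max B1 B2"])
    show "path (\<psi>0 +++ \<psi>1)" using \<open>path \<psi>0\<close> \<open>path \<psi>1\<close> join by simp
    show "(\<psi>0 +++ \<psi>1) 0 = 0"
      using pathstart_join[of \<psi>0 \<psi>1] \<sigma>(2) by (simp add: pathstart_def \<psi>0_def)
    show "(\<psi>0 +++ \<psi>1) 1 = lam \<or> (\<psi>0 +++ \<psi>1) 1 = - lam"
      using pathfinish_join[of \<psi>0 \<psi>1] p(2) by (simp add: pathfinish_def \<psi>1_def linepath_def)
    show "norm ((f ^^ m) z) \<le> max B1 B2" if "z \<in> path_image (\<psi>0 +++ \<psi>1)" for m z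
      using that bound0 bound1 join by (force simp: path_image_join le_max_iff_disj)
  qed
qed

end

section \<open>Orbits in the Fatou set are bounded\<close>

context parabolic_sine
begin

text \<open>The critical values are negatives of each other and f is odd, so the one reached by the
  path controls both.\<close>

lemma critical_orbits_bounded:
  obtains B where "B \<ge> 0" "\<And>n. norm ((f ^^ n) lam) \<le> B" "\<And>n. norm ((f ^^ n) (- lam)) \<le> B"
proof -
  obtain \<psi> B where \<psi>: "\<psi> 1 = lam \<or> \<psi> 1 = - lam"
    and B: "\<And>n z. z \<in> path_image \<psi> \<Longrightarrow> norm ((f ^^ n) z) \<le> B"
    using bounded_path_to_critical_value by metis
  have *: "norm ((f ^^ n) (\<psi> 1)) \<le> B" for n by (rule B) (simp add: path_image_def)
  show ?thesis
  proof
    show "B \<ge> 0" using *[of 0] norm_ge_zero order_trans by blast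
  qed (use * \<psi> in \<open>auto simp: funpow_f_minus\<close>)
qed

text \<open>Bloch's theorem is applied to the inverse branch G of f^n on the disc of radius R = |w|
  - B about w = f^n z, and to f^n on \<open>ball z r\<close>. This gives R |G'| < 84 and r |A| < 84;
  as A G' has modulus 1, R r <= 84^2 = 7056.\<close>

lemma orbit_bound_in_F:
  obtains B where "\<And>z r n. 0 < r \<Longrightarrow> ball z r \<subseteq> F \<Longrightarrow> n \<ge> 2 \<Longrightarrow> norm ((f ^^ n) z) \<le> B + 7056 / r"
proof -
  obtain B where B: "B \<ge> 0" "\<And>n. norm ((f ^^ n) lam) \<le> B" "\<And>n. norm ((f ^^ n) (- lam)) \<le> B"
    using critical_orbits_bounded by blast
  show ?thesis
  proof (rule that[of B], rule ccontr)
    fix z r n assume r: "0 < r" "ball z r \<subseteq> F" and n: "n \<ge> (2::nat)"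
      and "\<not> norm ((f ^^ n) z) \<le> B + 7056 / r"
    then have large: "norm ((f ^^ n) z) > B + 7056 / r" by simp
    define w where "w = (f ^^ n) z"
    define R where "R = norm w - B"
    have R: "R > 7056 / r" using large by (simp add: R_def w_def)
    then have R_pos: "R > 0" using r(1) by (meson divide_pos_pos less_trans zero_less_numeral)
    \<comment> \<open>This keeps the disc off both critical orbits, so that the lift exists, and
      also off 0.\<close>
    have away: "p \<notin> ball w R" if "norm p \<le> B" for p
      using that norm_triangle_sub[of w p] by (auto simp: R_def dist_norm)
    show False
    proof (rule iterated_lift[of "\<lambda>w. w" "ball w R" w n z])
      fix j G assume "G holomorphic_on ball w R" "\<And>v. v \<in> ball w R \<Longrightarrow> (f ^^ j) (G v) = v"
        "lam \<in> G ` ball w R \<or> - lam \<in> G ` ball w R"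
      then obtain p where "p \<in> ball w R" "p = (f ^^ j) lam \<or> p = (f ^^ j) (- lam)" by force
      then show False using away[of p] B by auto
    next
      fix G assume G: "G holomorphic_on ball w R" "G w = z" "\<And>v. v \<in> ball w R \<Longrightarrow> (f ^^ n) (G v) = v"
      define A where "A = deriv (f ^^ n) z"
      have A: "((f ^^ n) has_field_derivative A) (at z)"
        unfolding A_def by (rule holomorphic_derivI[OF funpow_f_holomorphic open_UNIV]) simp
      have derG: "(G has_field_derivative deriv G w) (at w)"
        using G(1) R_pos by (intro holomorphic_derivI[of _ "ball w R"]) auto
      have "((f ^^ n) \<circ> G has_field_derivative A * deriv G w) (at w)"
        by (rule DERIV_chain[OF _ derG]) (use A G(2) in simp)
      then have "((\<lambda>v. v) has_field_derivative A * deriv G w) (at w)"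
        by (rule has_field_derivative_transform_within_open[of _ _ _ "ball w R"]) (use G(3) R_pos in auto)
      from DERIV_unique[OF this DERIV_ident] have AG: "norm A * norm (deriv G w) = 1"
        by (metis norm_mult norm_one)
      \<comment> \<open>Otherwise the image of G contains a zero y of f^2; then f^n y = 0 as n >= 2,
        but the disc about w omits 0.\<close>
      have 1: "R * norm (deriv G w) / 12 < 7"
      proof (rule ccontr)
        assume "\<not> R * norm (deriv G w) / 12 < 7"
        then have "7 \<le> R * norm (deriv G w) / 12" by simp
        then obtain b where b: "ball b 7 \<subseteq> G ` ball w R"
          using Bloch[OF G(1) R_pos] by blast
        obtain y where y: "y \<in> ball b 7" "f (f y) = 0" by (rule ball_7_contains_zero_of_f2)
        then obtain v where v: "v \<in> ball w R" "y = G v" using b by blast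
        have "(f ^^ n) y = (f ^^ (n - 2)) ((f ^^ 2) y)"
          using n by (metis comp_apply funpow_add le_add_diff_inverse2)
        also have "(f ^^ 2) y = 0" using y by (simp add: numeral_2_eq_2)
        finally have "v = 0" using G(3)[OF v(1)] v by simp
        then show False using away[of 0] v B(1) by simp
      qed
      have 2: "r * norm A / 12 < 7"
      proof (rule ccontr)
        assume "\<not> r * norm A / 12 < 7"
        then have "7 \<le> r * norm (deriv (f ^^ n) z) / 12" by (simp add: A_def)
        then obtain b where "ball b 7 \<subseteq> (f ^^ n) ` ball z r"
          using Bloch[OF funpow_f_holomorphic r(1)] by blast
        then have "ball b 7 \<subseteq> F" using r(2) funpow_f_in_F by blast
        then show False using no_ball_7_in_F by blast
      qed
      have "(R * norm (deriv G w)) * (r * norm A) \<le> 84 * 84"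
        using 1 2 R_pos r(1) by (intro mult_mono) auto
      moreover have "(R * norm (deriv G w)) * (r * norm A) = R * r * (norm A * norm (deriv G w))"
        by (simp only: mult_ac)
      ultimately have "R * r \<le> 7056" unfolding AG by simp
      then show False using R r(1) by (simp add: divide_less_eq)
    qed (use R_pos in \<open>auto simp: w_def convex_imp_contractible\<close>)
  qed
qed

text \<open>Compactness gives one radius r for all points of X and bounds the iterates of index 0
  and 1, which \<open>orbit_bound_in_F\<close> leaves out.\<close>

lemma orbits_bounded_on_compact_in_F:
  assumes "compact X" "X \<subseteq> F"
  obtains B where "\<And>n z. z \<in> X \<Longrightarrow> norm ((f ^^ n) z) \<le> B"
proof -
  obtain B where B: "\<And>z r n. 0 < r \<Longrightarrow> ball z r \<subseteq> F \<Longrightarrow> n \<ge> 2 \<Longrightarrow> norm ((f ^^ n) z) \<le> B + 7056 / r"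
    using orbit_bound_in_F by blast
  obtain r where r: "r > 0" "(\<Union>x\<in>X. ball x r) \<subseteq> F"
    using compact_subset_open_imp_ball_epsilon_subset[OF assms(1) open_F assms(2)] by blast
  obtain B' where B': "\<And>i z. i < 2 \<Longrightarrow> z \<in> X \<Longrightarrow> norm ((f ^^ i) z) \<le> B'"
    using iterates_bounded_on_compact[OF assms(1)] by blast
  show ?thesis
  proof
    fix n z assume z: "z \<in> X"
    then have "norm ((f ^^ n) z) \<le> B + 7056 / r" if "n \<ge> 2"
      using r that by (intro B) auto
    then show "norm ((f ^^ n) z) \<le> max B' (B + 7056 / r)"
      using B'[OF _ z, of n] by (cases "n < 2") (auto simp: le_max_iff_disj)
  qed
qed

end

section \<open>Lifting paths through the sine, even across its critical values\<close>

lemma continuous_sqrt_of_path: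
  fixes h :: "real \<Rightarrow> complex"
  assumes h: "continuous_on UNIV h"
  obtains s where "continuous_on UNIV s" "\<And>t. s t ^ 2 = h t"
proof -
  \<comment> \<open>The signs can be chosen independently between consecutive zeros of \<open>h\<close>: continuity at a
    zero only depends on \<open>norm (s t) = sqrt (norm (h t))\<close>.\<close>
  define U where "U = {t. h t \<noteq> 0}"
  have "open U"
    unfolding U_def using h by (intro open_Collect_neq continuous_intros) auto
  have "\<exists>g. continuous_on C g \<and> (\<forall>t\<in>C. h t = g t ^ 2)" if "C \<in> components U" for C
  proof -
    have "connected C" "C \<subseteq> U"
      using that in_components_connected in_components_subset by blast+
    then have "contractible C"
      by (simp add: convex_imp_contractible is_interval_convex is_interval_connected_1)
    then obtain g where "continuous_on C g" "\<And>t. t \<in> C \<Longrightarrow> h t = g t ^ 2"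
      by (rule continuous_sqrt_on_contractible[OF continuous_on_subset[OF h subset_UNIV]])
        (use \<open>C \<subseteq> U\<close> in \<open>auto simp: U_def\<close>)
    then show ?thesis by blast
  qed
  then obtain g where g: "\<And>C. C \<in> components U \<Longrightarrow> continuous_on C (g C)"
      "\<And>C t. C \<in> components U \<Longrightarrow> t \<in> C \<Longrightarrow> h t = g C t ^ 2"
    by metis
  define s where "s t = (if h t = 0 then 0 else g (connected_component_set U t) t)" for t
  have comp: "connected_component_set U t \<in> components U" "t \<in> connected_component_set U t" if "h t \<noteq> 0" for t
    using that by (auto simp: U_def components_def)
  have s2: "s t ^ 2 = h t" for t
    using g(2)[OF comp] by (simp add: s_def)
  have "isCont s t" for t
  proof (cases "h t = 0")
    case False
    define C where "C = connected_component_set U t"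
    have C: "C \<in> components U" "t \<in> C" using comp[OF False] by (auto simp: C_def)
    have "open C" unfolding C_def by (rule open_connected_component[OF \<open>open U\<close>])
    have "s t' = g C t'" if "t' \<in> C" for t'
    proof -
      have "connected_component_set U t' = C"
        using that connected_component_eq unfolding C_def by blast
      moreover have "h t' \<noteq> 0" using that in_components_subset[OF C(1)] by (auto simp: U_def)
      ultimately show ?thesis by (simp add: s_def)
    qed
    then have "continuous_on C s" using g(1)[OF C(1)] by (simp cong: continuous_on_cong)
    then show ?thesis using \<open>open C\<close> C(2) by (simp add: continuous_on_eq_continuous_at)
  next
    case True
    have n: "norm (s t') = sqrt (norm (h t'))" for t'
      by (metis norm_ge_zero norm_power real_sqrt_unique s2)
    have "isCont h t" using h by (simp add: continuous_on_eq_continuous_at)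
    then have "((\<lambda>t'. sqrt (norm (h t'))) \<longlongrightarrow> sqrt (norm (h t))) (at t)"
      by (intro tendsto_intros) (simp add: isCont_def)
    then have "((\<lambda>t'. norm (s t')) \<longlongrightarrow> 0) (at t)" using True by (simp add: n)
    then show ?thesis
      using True by (simp add: isCont_def s_def[of t] tendsto_norm_zero_cancel)
  qed
  then show ?thesis using that[of s] s2 by (simp add: continuous_on_eq_continuous_at)
qed

text \<open>The equation exp (i z) = i w + sqrt (1 - w^2) is solved for z. The root vanishes where w
  meets 1 or -1, but the right-hand side never does: its inverse is sqrt (1 - w^2) - i w.\<close>

lemma arcsin_of_path:
  fixes w :: "real \<Rightarrow> complex"
  assumes w: "continuous_on UNIV w" and w0: "w 0 = 0"
  obtains z where "continuous_on UNIV z" "z 0 = 0" "\<And>t. sin (z t) = w t"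
proof -
  obtain s where s: "continuous_on UNIV s" "\<And>t. s t ^ 2 = 1 - w t ^ 2"
    by (rule continuous_sqrt_of_path[of "\<lambda>t. 1 - w t ^ 2"]) (auto intro!: continuous_intros w)
  define u where "u t = \<i> * w t + s t" for t
  have inv: "u t * (s t - \<i> * w t) = 1" for t
    using s(2)[of t] by (simp add: u_def algebra_simps power2_eq_square)
  have "continuous_on UNIV u" unfolding u_def by (intro continuous_intros w s)
  moreover have "u t \<noteq> 0" for t using inv[of t] by auto
  ultimately obtain g where g: "continuous_on UNIV g" "\<And>t. u t = exp (g t)"
    using continuous_logarithm_on_contractible[of UNIV u] by auto
  define z where "z t = - \<i> * g t" for t
  have z: "continuous_on UNIV z" unfolding z_def by (intro continuous_intros g)
  have sin_z: "sin (z t) = w t" for t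
  proof -
    have "exp (\<i> * z t) = u t" by (simp add: z_def g(2))
    moreover have "exp (- (\<i> * z t)) = s t - \<i> * w t"
    proof -
      have "exp (- (\<i> * z t)) = inverse (u t)"
        using \<open>exp (\<i> * z t) = u t\<close> by (simp add: exp_minus)
      then show ?thesis using inverse_unique[OF inv[of t]] by simp
    qed
    ultimately show ?thesis by (simp add: sin_exp_eq u_def field_simps)
  qed
  have "sin (z 0) = 0" using sin_z w0 by simp
  then obtain k :: int where k: "z 0 = of_real (k * pi)" by (auto simp: sin_eq_0)
  show ?thesis
  \<comment> \<open>Translation by z 0 = k pi preserves the sine for even k, reflection for odd k;
    either moves the start to 0.\<close>
  proof (cases "even k")
    case True
    then obtain m where m: "k = 2 * m" by (elim evenE)
    have "sin (z t - z 0) = sin (z t)" for t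
      unfolding k complex_sin_eq m by (intro bexI[of _ "- of_int m"]) auto
    then show ?thesis
      by (intro that[of "\<lambda>t. z t - z 0"] continuous_intros z) (simp_all add: sin_z)
  next
    case False
    then obtain m where m: "k = 2 * m + 1" by (elim oddE)
    have "sin (z 0 - z t) = sin (z t)" for t
      unfolding k complex_sin_eq m by (intro bexI[of _ "of_int m"]) auto
    then show ?thesis
      by (intro that[of "\<lambda>t. z 0 - z t"] continuous_intros z) (simp_all add: sin_z)
  qed
qed

section \<open>A vertical path with bounded orbits\<close>

context parabolic_sine
begin

text \<open>The preimage of a bounded-orbit path from \<open>0\<close> to a critical value, continued by reflection
  in the critical point \<open>c\<close> and translation by \<open>2 c\<close>.\<close>

lemma bounded_orbit_line:
  obtains L :: "real \<Rightarrow> complex" and c b B :: real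
  where "c \<noteq> 0" "continuous_on UNIV L" "L 0 = 0"
    "\<And>t. t \<ge> 0 \<Longrightarrow> norm (L t - of_real (c * t)) \<le> b"
    "\<And>t n. t \<ge> 0 \<Longrightarrow> n \<ge> 1 \<Longrightarrow> norm ((f ^^ n) (L t)) \<le> B"
proof -
  obtain \<psi> B where \<psi>: "path \<psi>" "\<psi> 0 = 0" "\<psi> 1 = lam \<or> \<psi> 1 = - lam"
    and B: "\<And>n z. z \<in> path_image \<psi> \<Longrightarrow> norm ((f ^^ n) z) \<le> B"
    using bounded_path_to_critical_value by metis
  \<comment> \<open>Clamping to [0, 1] extends the path by constants to the whole line.\<close>
  define cl where "cl t = max 0 (min 1 t)" for t :: real
  have cl: "cl t \<in> {0..1}" "t \<in> {0..1} \<Longrightarrow> cl t = t" "t \<le> 0 \<Longrightarrow> cl t = 0" "t \<ge> 1 \<Longrightarrow> cl t = 1" for t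
    by (auto simp: cl_def)
  have cont_cl: "continuous_on S (\<lambda>t. cl (g t))" if "continuous_on S g" for S and g :: "real \<Rightarrow> real"
    unfolding cl_def by (intro continuous_intros that)
  have "continuous_on UNIV (\<lambda>t. \<psi> (cl t))"
    by (rule continuous_on_compose2[OF \<psi>(1)[unfolded path_def] cont_cl[OF continuous_on_id]])
      (use cl(1) in auto)
  then have cont\<psi>: "continuous_on UNIV (\<lambda>t. \<psi> (cl t) / lam)"
    using lam_nonzero by (intro continuous_on_divide continuous_on_const) auto
  have "\<psi> (cl 0) / lam = 0" using \<psi>(2) cl(3)[of 0] by simp
  from arcsin_of_path[OF cont\<psi> this]
  obtain g where g: "continuous_on UNIV g" "g 0 = 0" "\<And>t. sin (g t) = \<psi> (cl t) / lam"
    by blast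
  have fg: "f (g t) = \<psi> (cl t)" for t using g(3)[of t] lam_nonzero by (simp add: f_def)
  have contg: "continuous_on S (\<lambda>t. g (h t))" if "continuous_on S h" for S and h :: "real \<Rightarrow> real"
    by (rule continuous_on_compose2[OF g(1) that]) auto
  \<comment> \<open>The lift ends where the sine is 1 or -1, that is at a critical point of f, which
    is real.\<close>
  have "sin (g 1) = 1 \<or> sin (g 1) = - 1"
    using g(3)[of 1] \<psi>(3) cl(4)[of 1] lam_nonzero by auto
  then have sin2: "sin (g 1) ^ 2 = 1" by auto
  then have cos0: "cos (g 1) = 0" using sin_cos_squared_add[of "g 1"] by simp
  then obtain k :: int where k: "g 1 = of_real (k * pi) + of_real pi / 2"
    using cos_eq_0 by blast
  define c where "c = k * pi + pi / 2"
  have c: "g 1 = of_real c" using k by (simp add: c_def)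
  have "c \<noteq> 0" using sin2 c by auto
  have s2c: "sin (2 * of_real c :: complex) = 0" "cos (2 * of_real c :: complex) = - 1"
    using cos0 sin2 unfolding c[symmetric] by (simp_all only: sin_double cos_double) auto
  have refl: "f (2 * of_real c - v) = f v" for v
    using s2c by (simp add: f_def sin_diff)
  \<comment> \<open>Translation by 2 c only changes the sign of f, which does not affect the norms
    along an orbit.\<close>
  have shift: "f (v + of_nat m * (2 * of_real c)) = f v \<or> f (v + of_nat m * (2 * of_real c)) = - f v" for v m
  proof (induction m)
    case (Suc m)
    have "f (v + of_nat (Suc m) * (2 * of_real c)) = f ((v + of_nat m * (2 * of_real c)) + 2 * of_real c)"
      by (simp add: algebra_simps)
    also have "\<dots> = - f (v + of_nat m * (2 * of_real c))"
      unfolding f_def using s2c by (subst sin_add) simp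
    finally show ?case using Suc by auto
  qed simp
  \<comment> \<open>One piece of the line: g on [0, 1], the reflected path 2 c - g (2 - s) on
    [1, 2], constant 0 before and 2 c after.\<close>
  define pc where "pc s = g (cl s) + of_real c - g (1 - cl (s - 1))" for s
  have contpc: "continuous_on S (\<lambda>t. pc (h t))" if "continuous_on S h" for S and h :: "real \<Rightarrow> real"
    unfolding pc_def by (intro continuous_intros contg cont_cl that)
  have pc_left: "pc s = 0" if "s \<le> 0" for s
    using that g(2) c by (simp add: pc_def cl)
  have pc_right: "pc s = 2 * of_real c" if "s \<ge> 2" for s
    using that g(2) c by (simp add: pc_def cl)
  have fpc: "f (pc s) \<in> path_image \<psi>" for s
  proof (cases "s \<le> 1")
    case True
    then have "pc s = g (cl s)" using c by (simp add: pc_def cl)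
    then show ?thesis using cl(1) by (simp add: fg path_image_def)
  next
    case False
    then have "pc s = 2 * of_real c - g (1 - cl (s - 1))" using c by (simp add: pc_def cl)
    then show ?thesis using cl(1) by (simp add: fg refl path_image_def)
  qed
  \<comment> \<open>Adding shifted copies concatenates the pieces: finished ones contribute 2 c
    each, one is active, and later ones vanish. So any N with t <= 2 N gives the same value at
    t.\<close>
  define S where "S N t = (\<Sum>k<N. pc (t - 2 * real k))" for N t
  have S_eq: "S N t = S M t" if "t \<le> 2 * real M" "M \<le> N" for N M t
    unfolding S_def
    by (rule sum.mono_neutral_right) (use that in \<open>auto intro!: pc_left simp: not_less\<close>)
  define L where "L t = S (nat \<lceil>t\<rceil> + 1) t" for t
  have L_eq: "L t = S N t" if "t \<le> 2 * real N" for N t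
  proof -
    have "t \<le> 2 * real (nat \<lceil>t\<rceil> + 1)" using real_nat_ceiling_ge[of t] by simp
    then show ?thesis
      using S_eq[of t N "nat \<lceil>t\<rceil> + 1"] S_eq[of t "nat \<lceil>t\<rceil> + 1" N] that
      unfolding L_def by (cases "N \<le> nat \<lceil>t\<rceil> + 1") auto
  qed
  have "isCont L t" for t
  proof -
    define N where "N = nat \<lceil>t\<rceil> + 1"
    have N: "t \<in> {..<2 * real N}" unfolding N_def using real_nat_ceiling_ge[of t] by simp
    have "continuous_on {..<2 * real N} (S N)"
      unfolding S_def by (intro continuous_intros contpc)
    then have "continuous_on {..<2 * real N} L"
      by (rule continuous_on_eq) (use L_eq[of _ N] in simp)
    then show ?thesis using N by (simp add: continuous_on_eq_continuous_at)
  qed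
  then have contL: "continuous_on UNIV L" by (simp add: continuous_on_eq_continuous_at)
  have L_val: "\<exists>m s. 0 \<le> s \<and> s \<le> 2 \<and> t = s + 2 * real m \<and> L t = pc s + of_nat m * (2 * of_real c)"
    if "t \<ge> 0" for t
  proof -
    define m where "m = nat \<lfloor>t / 2\<rfloor>"
    define s where "s = t - 2 * real m"
    have m: "real m = of_int \<lfloor>t / 2\<rfloor>" using that by (simp add: m_def)
    have s: "0 \<le> s" "s \<le> 2" unfolding s_def m by linarith+
    have "L t = S (Suc m) t" by (rule L_eq) (use s in \<open>simp add: s_def\<close>)
    also have "\<dots> = (\<Sum>k<m. pc (t - 2 * real k)) + pc s" by (simp add: S_def s_def)
    also have "(\<Sum>k<m. pc (t - 2 * real k)) = (\<Sum>k<m. 2 * of_real c)"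
    proof (rule sum.cong)
      fix k assume "k \<in> {..<m}"
      then have "real k + 1 \<le> real m" by simp
      then show "pc (t - 2 * real k) = 2 * of_real c"
        using s by (intro pc_right) (simp add: s_def)
    qed simp
    finally have "L t = pc s + of_nat m * (2 * of_real c)" by simp
    then show ?thesis using s by (intro exI[of _ m] exI[of _ s]) (simp add: s_def)
  qed
  have "compact ((\<lambda>s. pc s - of_real (c * s)) ` {0..2})"
    by (intro compact_continuous_image continuous_intros contpc) auto
  then have "bounded ((\<lambda>s. pc s - of_real (c * s)) ` {0..2})" by (rule compact_imp_bounded)
  then obtain b where "\<forall>y\<in>(\<lambda>s. pc s - of_real (c * s)) ` {0..2}. norm y \<le> b"
    unfolding bounded_iff by blast
  then have b: "norm (pc s - of_real (c * s)) \<le> b" if "0 \<le> s" "s \<le> 2" for s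
    using that by simp
  show ?thesis
  proof (rule that[OF \<open>c \<noteq> 0\<close> contL])
    show "L 0 = 0" using L_eq[of 0 0] by (simp add: S_def)
    show "norm (L t - of_real (c * t)) \<le> b" if t: "t \<ge> 0" for t
    proof -
      obtain m s where ms: "0 \<le> s" "s \<le> 2" "t = s + 2 * real m" "L t = pc s + of_nat m * (2 * of_real c)"
        using L_val[OF t] by blast
      have eq: "L t - of_real (c * t) = pc s - of_real (c * s)"
        unfolding ms(4) by (simp add: ms(3) algebra_simps)
      show ?thesis unfolding eq by (rule b[OF ms(1,2)])
    qed
    show "norm ((f ^^ n) (L t)) \<le> B" if t: "t \<ge> 0" and n: "n \<ge> 1" for t n
    proof -
      obtain m s where ms: "L t = pc s + of_nat m * (2 * of_real c)"
        using L_val[OF t] by blast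
      obtain n' where n': "n = Suc n'" using n by (cases n) auto
      have "norm ((f ^^ n) (L t)) = norm ((f ^^ n') (f (L t)))"
        by (simp add: n' funpow_Suc_right del: funpow.simps)
      also have "\<dots> = norm ((f ^^ n') (f (pc s)))"
        using shift[of "pc s" m] unfolding ms by (auto simp: funpow_f_minus)
      also have "\<dots> \<le> B" by (rule B[OF fpc])
      finally show ?thesis .
    qed
  qed
qed

section \<open>Vertical lines and the direction of the values of f\<close>

lemma f_eq_exp: "f z = lam / (2 * \<i>) * (cis (Re z) * exp (- of_real (Im z)) - cis (- Re z) * exp (of_real (Im z)))"
proof -
  have "\<i> * z = \<i> * of_real (Re z) + - of_real (Im z)"
    by (simp add: complex_eq_iff)
  then have "exp (\<i> * z) = cis (Re z) * exp (- of_real (Im z))"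
    by (simp only: exp_add cis_conv_exp)
  moreover have "- (\<i> * z) = \<i> * of_real (- Re z) + of_real (Im z)"
    by (simp add: complex_eq_iff)
  then have "exp (- (\<i> * z)) = cis (- Re z) * exp (of_real (Im z))"
    by (simp only: exp_add cis_conv_exp)
  ultimately show ?thesis by (simp add: f_def sin_exp_eq)
qed

text \<open>On the lines where cis (Re z) = u = -i lam \<open>\<sigma>\<close>, the dominant term of
  f is -\<open>\<sigma>\<close> exp y / 2 and the other has modulus exp (-y) / 2. A path in the
  upper half-plane whose image stays in \<open>\<sigma> * Re > 0\<close> therefore avoids these
  lines.\<close>

lemma opposite_direction_above:
  assumes "\<sigma> = 1 \<or> \<sigma> = (- 1 :: real)"
  obtains x0 where "\<And>z. cis (Re z) = cis x0 \<Longrightarrow> Im z > 0 \<Longrightarrow> \<sigma> * Re (f z) \<le> 0"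
proof -
  define u where "u = - \<i> * lam * of_real \<sigma>"
  have u: "norm u = 1" using assms norm_lam by (auto simp: u_def norm_mult)
  then obtain x0 where x0: "u = cis x0" by (metis complex_norm_eq_1_exp cis_conv_exp)
  show ?thesis
  proof (rule that[of x0])
    fix z assume z: "cis (Re z) = cis x0" "Im z > 0"
    define y where "y = Im z"
    have "cis (- Re z) = inverse (cis (Re z))" by (simp add: cis_inverse)
    also have "\<dots> = inverse u" by (simp only: z(1) x0)
    finally have "of_real \<sigma> * f z = of_real \<sigma> * (lam / (2 * \<i>) * (u * exp (- of_real y) - inverse u * exp (of_real y)))"
      unfolding f_eq_exp y_def z(1) x0[symmetric] by simp
    also have "\<dots> = (of_real \<sigma> * lam * u / (2 * \<i>)) * of_real (exp (- y)) - of_real (exp y / 2)"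
      using assms lam_nonzero by (auto simp: u_def field_simps simp flip: exp_of_real)
    finally have "Re (of_real \<sigma> * f z) = Re ((of_real \<sigma> * lam * u / (2 * \<i>)) * of_real (exp (- y))) - exp y / 2"
      by simp
    moreover have "Re ((of_real \<sigma> * lam * u / (2 * \<i>)) * of_real (exp (- y))) \<le> exp (- y) / 2"
      using complex_Re_le_cmod[of "(of_real \<sigma> * lam * u / (2 * \<i>)) * of_real (exp (- y))"] assms u norm_lam
      by (auto simp: norm_mult norm_divide)
    moreover have "exp (- y) \<le> exp y" using z(2) by (simp add: y_def)
    moreover have "q \<le> 0" if "q = p - E / 2" "p \<le> e / 2" "e \<le> E" for p q e E :: real
      using that by simp
    ultimately have "Re (of_real \<sigma> * f z) \<le> 0" by blast
    then show "\<sigma> * Re (f z) \<le> 0" by simp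
  qed
qed

text \<open>The reflection of z to pi - z preserves f and exchanges the half-planes.\<close>

lemma opposite_direction_below:
  assumes "\<sigma> = 1 \<or> \<sigma> = (- 1 :: real)"
  obtains x0 where "\<And>z. cis (Re z) = cis x0 \<Longrightarrow> Im z < 0 \<Longrightarrow> \<sigma> * Re (f z) \<le> 0"
proof -
  obtain x0 where x0: "\<And>z. cis (Re z) = cis x0 \<Longrightarrow> Im z > 0 \<Longrightarrow> \<sigma> * Re (f z) \<le> 0"
    using opposite_direction_above[OF assms] by blast
  show ?thesis
  proof (rule that[of "pi - x0"])
    fix z assume z: "cis (Re z) = cis (pi - x0)" "Im z < 0"
    have "cis (Re (of_real pi - z)) = cis x0"
      using z(1) by (simp add: complex_eq_iff)
    moreover have "f (of_real pi - z) = f z" by (simp add: f_def sin_diff)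
    ultimately show "\<sigma> * Re (f z) \<le> 0" using x0[of "of_real pi - z"] z(2) by simp
  qed
qed

text \<open>By the intermediate value theorem g cannot leave a gap between neighbouring points of x0
  + 2 pi Z.\<close>

lemma bounded_variation_avoiding:
  fixes g :: "real \<Rightarrow> real"
  assumes g: "continuous_on {a..} g" and avoid: "\<And>t. t \<ge> a \<Longrightarrow> cis (g t) \<noteq> cis x0"
    and t: "t \<ge> a"
  shows "\<bar>g t - g a\<bar> \<le> 2 * pi"
proof (rule ccontr)
  assume far: "\<not> \<bar>g t - g a\<bar> \<le> 2 * pi"
  define m where "m = min (g t) (g a)"
  \<comment> \<open>Makes y the first point of x0 + 2 pi Z at or above m.\<close>
  define k where "k = \<lceil>(m - x0) / (2 * pi)\<rceil>"
  define y where "y = x0 + 2 * pi * k"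
  have "(m - x0) / (2 * pi) \<le> k" "k \<le> (m - x0) / (2 * pi) + 1" unfolding k_def by linarith+
  then have "m \<le> y" "y \<le> m + 2 * pi" by (simp_all add: y_def field_simps)
  then have y: "m \<le> y" "y \<le> max (g t) (g a)" using far by (auto simp: m_def)
  have cont: "continuous_on {a..t} g" using g by (rule continuous_on_subset) auto
  have "\<exists>s\<ge>a. g s = y"
  proof (cases "g a \<le> g t")
    case True
    then show ?thesis using IVT'[of g a y t] y t cont by (auto simp: m_def)
  next
    case False
    then show ?thesis using IVT2'[of g t y a] y t cont by (auto simp: m_def)
  qed
  then obtain s where "s \<ge> a" "g s = y" by blast
  moreover have "cis y = cis x0"
    by (simp add: y_def cis.code cos_add sin_add)
  ultimately show False using avoid by metis
qed

text \<open>A lift of the line of \<open>bounded_orbit_line\<close>: its ends are vertical because the line is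
  asymptotically horizontal.\<close>

lemma vertical_bounded_orbit_path:
  obtains V :: "real \<Rightarrow> complex" and C B
  where "continuous_on UNIV V" "V 0 = 0" "\<And>t. t \<ge> 0 \<Longrightarrow> \<bar>Re (V t)\<bar> \<le> C"
    "\<And>y. \<exists>t\<ge>0. \<bar>Im (V t)\<bar> > y"
    "\<And>t n. t \<ge> 0 \<Longrightarrow> n \<ge> 2 \<Longrightarrow> norm ((f ^^ n) (V t)) \<le> B"
proof -
  obtain L c b B where c: "c \<noteq> 0" and L: "continuous_on UNIV L" "L 0 = 0"
    and dev: "\<And>t. t \<ge> 0 \<Longrightarrow> norm (L t - of_real (c * t)) \<le> b"
    and B: "\<And>t n. t \<ge> 0 \<Longrightarrow> n \<ge> 1 \<Longrightarrow> norm ((f ^^ n) (L t)) \<le> B"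
    using bounded_orbit_line by metis
  have "continuous_on UNIV (\<lambda>t. L t / lam)" using lam_nonzero by (intro continuous_intros L) auto
  then obtain V where V: "continuous_on UNIV V" "V 0 = 0" "\<And>t. sin (V t) = L t / lam"
    by (rule arcsin_of_path) (use L(2) in auto)
  have fV: "f (V t) = L t" for t using V(3)[of t] lam_nonzero by (simp add: f_def)
  define \<sigma> where "\<sigma> = sgn c"
  have \<sigma>: "\<sigma> = 1 \<or> \<sigma> = - 1" "\<sigma> * c = \<bar>c\<bar>" using c by (auto simp: \<sigma>_def sgn_if)
  have Re_L: "\<sigma> * Re (L t) \<ge> \<bar>c\<bar> * t - b" if "t \<ge> 0" for t
  proof -
    have "\<bar>\<sigma> * Re (L t - of_real (c * t))\<bar> \<le> b"
      using dev[OF that] abs_Re_le_cmod[of "L t - of_real (c * t)"] \<sigma>(1) by (auto simp: abs_mult)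
    moreover have "\<sigma> * Re (L t - of_real (c * t)) = \<sigma> * Re (L t) - \<bar>c\<bar> * t"
      unfolding \<sigma>(2)[symmetric] by (simp add: algebra_simps)
    ultimately show ?thesis by linarith
  qed
  have norm_L: "norm (L t) \<ge> \<bar>c\<bar> * t - b" if "t \<ge> 0" for t
    using Re_L[OF that] abs_Re_le_cmod[of "L t"] \<sigma>(1) by auto
  \<comment> \<open>From a on, \<open>\<sigma> * Re (L t)\<close> is at least 2: this exceeds the
    bound 1 for |f| on the real axis and is incompatible with the lines of opposite
    direction.\<close>
  define a where "a = max 0 ((b + 2) / \<bar>c\<bar>)"
  have a: "\<bar>c\<bar> * t - b \<ge> 2" "t \<ge> 0" if "t \<ge> a" for t
    using that c by (auto simp: a_def field_simps)
  have Im_nz: "Im (V t) \<noteq> 0" if "t \<ge> a" for t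
    using norm_f_bounds(1)[of "V t"] norm_L[of t] a[OF that] by (auto simp: fV)
  have cont: "continuous_on S (\<lambda>t. Re (V t))" "continuous_on S (\<lambda>t. Im (V t))" for S
    by (auto intro!: continuous_intros continuous_on_subset[OF V(1)])
  have "(\<forall>t\<ge>a. Im (V t) > 0) \<or> (\<forall>t\<ge>a. Im (V t) < 0)"
  proof -
    have "connected ((\<lambda>t. Im (V t)) ` {a..})"
      by (intro connected_continuous_image cont) auto
    then have "is_interval ((\<lambda>t. Im (V t)) ` {a..})" by (simp add: is_interval_connected_1)
    moreover have "0 \<notin> (\<lambda>t. Im (V t)) ` {a..}" using Im_nz by force
    ultimately have "\<not> (Im (V s) < 0 \<and> Im (V t) > 0)" if "s \<ge> a" "t \<ge> a" for s t
      using mem_is_interval_1_I[of _ "Im (V s)" "Im (V t)" 0] that by auto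
    then show ?thesis using Im_nz by (meson linorder_neqE_linordered_idom)
  qed
  then have "\<exists>x0. \<forall>t\<ge>a. cis (Re (V t)) \<noteq> cis x0"
  proof
    assume *: "\<forall>t\<ge>a. Im (V t) > 0"
    obtain x0 where x0: "\<And>z. cis (Re z) = cis x0 \<Longrightarrow> Im z > 0 \<Longrightarrow> \<sigma> * Re (f z) \<le> 0"
      using opposite_direction_above[OF \<sigma>(1)] by blast
    have "cis (Re (V t)) \<noteq> cis x0" if "t \<ge> a" for t
      using x0[of "V t"] * Re_L[of t] a[OF that] that by (auto simp: fV)
    then show ?thesis by blast
  next
    assume *: "\<forall>t\<ge>a. Im (V t) < 0"
    obtain x0 where x0: "\<And>z. cis (Re z) = cis x0 \<Longrightarrow> Im z < 0 \<Longrightarrow> \<sigma> * Re (f z) \<le> 0"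
      using opposite_direction_below[OF \<sigma>(1)] by blast
    have "cis (Re (V t)) \<noteq> cis x0" if "t \<ge> a" for t
      using x0[of "V t"] * Re_L[of t] a[OF that] that by (auto simp: fV)
    then show ?thesis by blast
  qed
  then obtain x0 where x0: "\<And>t. t \<ge> a \<Longrightarrow> cis (Re (V t)) \<noteq> cis x0" by blast
  have far: "\<bar>Re (V t) - Re (V a)\<bar> \<le> 2 * pi" if "t \<ge> a" for t
    by (rule bounded_variation_avoiding[OF cont(1) x0 that])
  have "compact ((\<lambda>t. Re (V t)) ` {0..a})" by (intro compact_continuous_image cont) auto
  then have "bounded ((\<lambda>t. Re (V t)) ` {0..a})" by (rule compact_imp_bounded)
  then obtain M where M: "\<And>t. 0 \<le> t \<Longrightarrow> t \<le> a \<Longrightarrow> \<bar>Re (V t)\<bar> \<le> M"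
    unfolding bounded_iff real_norm_def by (metis atLeastAtMost_iff imageI)
  show ?thesis
  proof (rule that[OF V(1,2)])
    show "\<bar>Re (V t)\<bar> \<le> M + 2 * pi" if "t \<ge> 0" for t
    proof (cases "t \<le> a")
      case True
      then show ?thesis using M[OF that] pi_gt_zero by linarith
    next
      case False
      then show ?thesis using far[of t] M[of a] a(2)[of a] by linarith
    qed
    show "\<exists>t\<ge>0. \<bar>Im (V t)\<bar> > y" for y
    proof (rule ccontr)
      assume *: "\<not> (\<exists>t\<ge>0. \<bar>Im (V t)\<bar> > y)"
      \<comment> \<open>At this t, |L t| > exp y, whereas |Im (V t)| <= y forces |f (V t)| <= exp
        y.\<close>
      define t where "t = max 0 ((exp y + \<bar>b\<bar> + 1) / \<bar>c\<bar>)"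
      have t: "t \<ge> 0" "\<bar>c\<bar> * t \<ge> exp y + \<bar>b\<bar> + 1"
        using c by (auto simp: t_def max_def field_simps)
      have "\<bar>Im (V t)\<bar> \<le> y" using * t(1) by (auto simp: not_less)
      then have "exp \<bar>Im (V t)\<bar> \<le> exp y" "exp (- \<bar>Im (V t)\<bar>) \<le> exp y" by simp_all
      moreover have "q \<le> E" if "q \<le> (p + e) / 2" "p \<le> E" "e \<le> E" for p q e E :: real
        using that by simp
      ultimately have "norm (L t) \<le> exp y" using norm_f_bounds(1)[of "V t"] unfolding fV by blast
      then show False using norm_L[OF t(1)] t(2) by linarith
    qed
    show "norm ((f ^^ n) (V t)) \<le> B" if "t \<ge> 0" and n: "n \<ge> 2" for t n
    proof -
      obtain m where m: "n = Suc m" "m \<ge> 1" using n by (cases n) auto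
      then show ?thesis using B[OF that(1) m(2)] by (simp add: funpow_Suc_right fV del: funpow.simps)
    qed
  qed
qed

end

section \<open>Boundedness of the Fatou components\<close>

text \<open>Prolonging h horizontally and v vertically to the sides of a large square makes the
  Fashoda theorem applicable. The bounds on Im along h and on Re along v keep the common point off
  the added segments.\<close>

lemma crossing_paths_intersect:
  fixes h v :: "real \<Rightarrow> complex"
  assumes h: "path h" "\<And>z. z \<in> path_image h \<Longrightarrow> \<bar>Im z\<bar> < T"
      "Re (pathstart h) \<le> - A" "Re (pathfinish h) \<ge> A"
    and v: "path v" "\<And>z. z \<in> path_image v \<Longrightarrow> \<bar>Re z\<bar> < A"
      "Im (pathstart v) \<le> - T" "Im (pathfinish v) \<ge> T"
  shows "path_image h \<inter> path_image v \<noteq> {}"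
proof -
  have "bounded (path_image h \<union> path_image v)"
    using h(1) v(1) by (simp add: bounded_path_image)
  then obtain R where R: "\<And>z. z \<in> path_image h \<union> path_image v \<Longrightarrow> norm z \<le> R"
    by (auto simp: bounded_iff)
  have Re_R: "\<bar>Re z\<bar> \<le> R" and Im_R: "\<bar>Im z\<bar> \<le> R" if "z \<in> path_image h \<union> path_image v" for z
    using R[OF that] abs_Re_le_cmod[of z] abs_Im_le_cmod[of z] by linarith+
  define l where "l = Complex (- R) (Im (pathstart h))"
  define r where "r = Complex R (Im (pathfinish h))"
  define b where "b = Complex (Re (pathstart v)) (- R)"
  define t where "t = Complex (Re (pathfinish v)) R"
  define h' where "h' = linepath l (pathstart h) +++ h +++ linepath (pathfinish h) r"
  define v' where "v' = linepath b (pathstart v) +++ v +++ linepath (pathfinish v) t"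
  have ends: "pathstart h \<in> path_image h" "pathfinish h \<in> path_image h"
      "pathstart v \<in> path_image v" "pathfinish v \<in> path_image v"
    by (rule pathstart_in_path_image pathfinish_in_path_image)+
  have hseg: "z \<in> closed_segment l (pathstart h) \<Longrightarrow> Im z = Im (pathstart h) \<and> - R \<le> Re z \<and> Re z \<le> Re (pathstart h)"
      "z \<in> closed_segment (pathfinish h) r \<Longrightarrow> Im z = Im (pathfinish h) \<and> Re z \<le> R \<and> Re z \<ge> Re (pathfinish h)" for z
    using Re_R[of "pathstart h"] Re_R[of "pathfinish h"] ends
    by (auto simp: closed_segment_same_Im l_def r_def closed_segment_eq_real_ivl split: if_splits)
  have vseg: "z \<in> closed_segment b (pathstart v) \<Longrightarrow> Re z = Re (pathstart v) \<and> - R \<le> Im z \<and> Im z \<le> Im (pathstart v)"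
      "z \<in> closed_segment (pathfinish v) t \<Longrightarrow> Re z = Re (pathfinish v) \<and> Im z \<le> R \<and> Im z \<ge> Im (pathfinish v)" for z
    using Im_R[of "pathstart v"] Im_R[of "pathfinish v"] ends
    by (auto simp: closed_segment_same_Re b_def t_def closed_segment_eq_real_ivl split: if_splits)
  have path_h': "path h'" and path_v': "path v'"
    using h(1) v(1) by (simp_all add: h'_def v'_def)
  have img_h': "path_image h' = closed_segment l (pathstart h) \<union> path_image h \<union> closed_segment (pathfinish h) r"
    by (auto simp: h'_def path_image_join)
  have img_v': "path_image v' = closed_segment b (pathstart v) \<union> path_image v \<union> closed_segment (pathfinish v) t"
    by (auto simp: v'_def path_image_join)
  \<comment> \<open>The identification of the plane with \<open>real ^ 2\<close>, the setting of
    \<open>fashoda\<close>.\<close>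
  define e :: "complex \<Rightarrow> real ^ 2" where "e z = vec_lambda (\<lambda>i. if i = 1 then Re z else Im z)" for z
  have e: "e z $ 1 = Re z" "e z $ 2 = Im z" for z by (simp_all add: e_def)
  have "continuous_on S (\<lambda>z. if i = 1 then Re z else Im z)" for i :: 2 and S
    by (cases "i = 1") (auto intro!: continuous_intros)
  then have cont_e: "continuous_on S e" for S
    unfolding e_def by (rule continuous_on_vec_lambda)
  have inj_e: "e z = e w \<Longrightarrow> z = w" for z w by (metis e complex_eqI)
  have box: "e z \<in> cbox (e (Complex (- R) (- R))) (e (Complex R R))" if "\<bar>Re z\<bar> \<le> R" "\<bar>Im z\<bar> \<le> R" for z
    using that by (auto simp: mem_box_cart forall_2 e)
  obtain z where "z \<in> path_image (e \<circ> h')" "z \<in> path_image (e \<circ> v')"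
  proof (rule fashoda[of "e \<circ> h'" "e \<circ> v'" "e (Complex (- R) (- R))" "e (Complex R R)"])
    show "path (e \<circ> h')" "path (e \<circ> v')"
      using path_h' path_v' cont_e by (auto intro: path_continuous_image)
    show "path_image (e \<circ> h') \<subseteq> cbox (e (Complex (- R) (- R))) (e (Complex R R))"
    proof (unfold path_image_compose, rule image_subsetI)
      fix z assume "z \<in> path_image h'"
      then show "e z \<in> cbox (e (Complex (- R) (- R))) (e (Complex R R))"
        using hseg[of z] Re_R[of z] Im_R[of z] Re_R[OF UnI1[OF ends(1)]] Re_R[OF UnI1[OF ends(2)]]
          Im_R[OF UnI1[OF ends(1)]] Im_R[OF UnI1[OF ends(2)]]
        unfolding img_h' by (elim UnE) (auto intro!: box simp: abs_le_iff)
    qed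
    show "path_image (e \<circ> v') \<subseteq> cbox (e (Complex (- R) (- R))) (e (Complex R R))"
    proof (unfold path_image_compose, rule image_subsetI)
      fix z assume "z \<in> path_image v'"
      then show "e z \<in> cbox (e (Complex (- R) (- R))) (e (Complex R R))"
        using vseg[of z] Re_R[of z] Im_R[of z] Re_R[OF UnI2[OF ends(3)]] Re_R[OF UnI2[OF ends(4)]]
          Im_R[OF UnI2[OF ends(3)]] Im_R[OF UnI2[OF ends(4)]]
        unfolding img_v' by (elim UnE) (auto intro!: box simp: abs_le_iff)
    qed
    show "pathstart (e \<circ> h') $ 1 = e (Complex (- R) (- R)) $ 1" "pathfinish (e \<circ> h') $ 1 = e (Complex R R) $ 1"
      by (simp_all add: pathstart_compose pathfinish_compose e h'_def l_def r_def)
    show "pathstart (e \<circ> v') $ 2 = e (Complex (- R) (- R)) $ 2" "pathfinish (e \<circ> v') $ 2 = e (Complex R R) $ 2"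
      by (simp_all add: pathstart_compose pathfinish_compose e v'_def b_def t_def)
  qed
  then obtain z where z: "z \<in> path_image h'" "z \<in> path_image v'"
    by (auto simp: path_image_compose dest: inj_e)
  have 1: "\<bar>Im z\<bar> < T"
    using z(1) hseg[of z] h(2) ends unfolding img_h' by fastforce
  have 2: "\<bar>Re z\<bar> < A"
    using z(2) vseg[of z] v(2) ends unfolding img_v' by fastforce
  have "z \<in> path_image h" using z(1) hseg[of z] h(3,4) 2 unfolding img_h' by force
  moreover have "z \<in> path_image v" using z(2) vseg[of z] v(3,4) 1 unfolding img_v' by force
  ultimately show ?thesis by blast
qed

context parabolic_sine
begin

text \<open>The barrier Y built from a wide path and two translates of W carries bounded iterates,
  so it cannot enclose 0. But a symmetric component escaping upwards and downwards between the
  translates would have to cross the path.\<close>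

lemma horizontal_extent_of_paths_in_F:
  obtains D where "\<And>\<gamma>. path \<gamma> \<Longrightarrow> path_image \<gamma> \<subseteq> F \<Longrightarrow> \<bar>Re (pathfinish \<gamma>) - Re (pathstart \<gamma>)\<bar> \<le> D"
proof -
  obtain V :: "real \<Rightarrow> complex" and C B where V: "continuous_on UNIV V" "V 0 = 0" "\<And>t. t \<ge> 0 \<Longrightarrow> \<bar>Re (V t)\<bar> \<le> C"
    "\<And>y. \<exists>t\<ge>0. \<bar>Im (V t)\<bar> > y"
    and B: "\<And>t n. t \<ge> 0 \<Longrightarrow> n \<ge> 2 \<Longrightarrow> norm ((f ^^ n) (V t)) \<le> B"
    using vertical_bounded_orbit_path by blast
  have C: "C \<ge> 0" using V(3)[of 0] by simp
  define W0 where "W0 = V ` {0..} \<union> uminus ` V ` {0..}"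
  \<comment> \<open>The bounds on Re and on the iterates are closed conditions and pass to the
    closure; closedness of W makes Y closed.\<close>
  define W where "W = closure W0"
  have "closed W" by (simp add: W_def)
  have W0_W: "W0 \<subseteq> W" unfolding W_def by (rule closure_subset)
  have W_Re: "\<bar>Re z\<bar> \<le> C" if "z \<in> W" for z
  proof -
    have "W \<subseteq> {z. \<bar>Re z\<bar> \<le> C}"
      unfolding W_def using V(3)
      by (intro closure_minimal closed_Collect_le continuous_intros) (auto simp: W0_def)
    then show ?thesis using that by blast
  qed
  have W_B: "norm ((f ^^ n) z) \<le> B" if "z \<in> W" "n \<ge> 2" for z n
  proof -
    have "W \<subseteq> {z. norm ((f ^^ n) z) \<le> B}"
      unfolding W_def using B that(2)
      by (intro closure_minimal closed_Collect_le continuous_intros funpow_f_continuous)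
        (auto simp: W0_def funpow_f_minus)
    then show ?thesis using that by blast
  qed
  have W_minus: "- z \<in> W" if "z \<in> W" for z
  proof -
    have "W0 \<subseteq> uminus ` W" using W0_W unfolding W0_def by (force simp: image_iff)
    then have "W \<subseteq> uminus ` W"
      unfolding W_def by (rule closure_minimal) (simp add: closed_negations)
    then show ?thesis using that by force
  qed
  \<comment> \<open>V and -V both start at 0 and run to opposite points, so joined they cross every
    horizontal strip.\<close>
  have crossW: "\<exists>v. path v \<and> path_image v \<subseteq> W \<and> Im (pathstart v) \<le> - y \<and> Im (pathfinish v) \<ge> y" for y
  proof -
    obtain t where t: "t \<ge> 0" "\<bar>Im (V t)\<bar> > y" using V(4) by blast
    define p where "p = V \<circ> (\<lambda>s. t * s)"
    define m where "m = uminus \<circ> p"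
    have p: "path p" "path m"
      unfolding p_def m_def path_def comp_def
      by (auto intro!: continuous_intros continuous_on_compose2[OF V(1)])
    have ends: "pathstart p = 0" "pathstart m = 0" "pathfinish p = V t" "pathfinish m = - V t"
      using V(2) by (simp_all add: p_def m_def pathstart_def pathfinish_def)
    have img: "path_image p \<subseteq> W" "path_image m \<subseteq> W"
      using t(1) by (auto simp: path_image_def p_def m_def W0_def intro!: subsetD[OF W0_W])
    show ?thesis
    proof (cases "Im (V t) > 0")
      case True
      have "path (reversepath m +++ p)" using p ends
        by (intro path_join_imp) auto
      moreover have "path_image (reversepath m +++ p) \<subseteq> W"
        using path_image_join_subset[of "reversepath m" p] img by auto
      ultimately show ?thesis using True t(2) ends
        by (intro exI[of _ "reversepath m +++ p"]) auto
    next
      case False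
      have "path (reversepath p +++ m)" using p ends
        by (intro path_join_imp) auto
      moreover have "path_image (reversepath p +++ m) \<subseteq> W"
        using path_image_join_subset[of "reversepath p" m] img by auto
      ultimately show ?thesis using False t(2) ends
        by (intro exI[of _ "reversepath p +++ m"]) auto
    qed
  qed
  \<comment> \<open>Makes s > C + 1, so the translates of W lie strictly on either side of 0; as a
    multiple of 2 pi, s does not change the iterates.\<close>
  define k where "k = nat \<lceil>C\<rceil> + 1"
  define s where "s = 2 * real k * pi"
  have s: "s > C + 1"
  proof -
    have "real k \<ge> C + 1" unfolding k_def using real_nat_ceiling_ge[of C] by simp
    moreover have "2 * real k * 1 \<le> s" unfolding s_def using pi_gt3 by (intro mult_left_mono) auto
    ultimately show ?thesis using C by linarith
  qed
  define A where "A = s + C + 1"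
  have period: "(f ^^ n) (of_real s + z) = (f ^^ n) z" "(f ^^ n) (- of_real s + z) = (f ^^ n) z" if "n \<ge> 2" for n z
    using that funpow_f_periodic[of n z "int k"] funpow_f_periodic[of n z "- int k"]
    by (simp_all add: s_def add.commute)
  \<comment> \<open>Moving the start to the left of -A by a multiple of 2 pi can overshoot by up to
    2 pi, and the end must still reach A.\<close>
  define D where "D = 2 * A + 2 * pi"
  have main: False if \<gamma>: "path \<gamma>" "path_image \<gamma> \<subseteq> F" "Re (pathfinish \<gamma>) - Re (pathstart \<gamma>) > D" for \<gamma>
  proof -
    define j where "j = \<lfloor>(- A - Re (pathstart \<gamma>)) / (2 * pi)\<rfloor>"
    have j: "2 * j * pi \<le> - A - Re (pathstart \<gamma>)" "- A - Re (pathstart \<gamma>) \<le> 2 * j * pi + 2 * pi"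
    proof -
      have "of_int j \<le> (- A - Re (pathstart \<gamma>)) / (2 * pi)"
          "(- A - Re (pathstart \<gamma>)) / (2 * pi) \<le> of_int j + 1"
        unfolding j_def by linarith+
      then show "2 * j * pi \<le> - A - Re (pathstart \<gamma>)" "- A - Re (pathstart \<gamma>) \<le> 2 * j * pi + 2 * pi"
        by (simp_all add: field_simps)
    qed
    define g where "g = (\<lambda>z. z + 2 * of_int j * of_real pi) \<circ> \<gamma>"
    have g: "path g" "Re (pathstart g) \<le> - A" "Re (pathfinish g) \<ge> A"
    proof -
      show "path g" unfolding g_def using \<gamma>(1) by (intro path_continuous_image continuous_intros)
      show "Re (pathstart g) \<le> - A" "Re (pathfinish g) \<ge> A"
        using j \<gamma>(3) by (simp_all add: g_def pathstart_compose pathfinish_compose D_def)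
    qed
    obtain BX where BX: "\<And>n z. z \<in> path_image \<gamma> \<Longrightarrow> norm ((f ^^ n) z) \<le> BX"
      using orbits_bounded_on_compact_in_F[OF compact_path_image \<gamma>(2)] \<gamma>(1) by blast
    define X where "X = path_image g"
    have X_B: "norm ((f ^^ n) z) \<le> BX" if "z \<in> X" "n \<ge> 2" for z n
      using that BX funpow_f_periodic[of n _ j] by (auto simp: X_def g_def path_image_compose)
    have "0 \<notin> X"
    proof
      assume "0 \<in> X"
      then obtain y where y: "y \<in> path_image \<gamma>" "y + 2 * of_int j * of_real pi = 0"
        by (auto simp: X_def g_def path_image_compose)
      then have "(f ^^ 1) y = 0" using f_periodic[of y j] by simp
      then show False using zero_orbit_notin_F y(1) \<gamma>(2) by blast
    qed
    define Y where "Y = X \<union> uminus ` X \<union> (+) (of_real s) ` W \<union> (+) (- of_real s) ` W"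
    have "compact X" using g(1) by (simp add: X_def compact_path_image)
    have "closed Y"
      unfolding Y_def using \<open>closed W\<close> compact_imp_closed[OF \<open>compact X\<close>]
      by (intro closed_Un closed_negations closed_translation)
    have Y_minus: "- z \<in> Y" if zY: "z \<in> Y" for z
    proof -
      consider "z \<in> X" | "z \<in> uminus ` X" | w where "w \<in> W" "z = of_real s + w"
        | w where "w \<in> W" "z = - of_real s + w"
        using zY unfolding Y_def by blast
      then show ?thesis
      proof cases
        case (3 w)
        then have "- z = - of_real s + - w" by simp
        then show ?thesis unfolding Y_def using W_minus[OF 3(1)] by blast
      next
        case (4 w)
        then have "- z = of_real s + - w" by simp
        then show ?thesis unfolding Y_def using W_minus[OF 4(1)] by blast
      qed (auto simp: Y_def)
    qed
    have Y_B: "norm ((f ^^ n) z) \<le> max B BX" if "z \<in> Y" "n \<ge> 2" for z n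
      using that X_B W_B period unfolding Y_def
      by (auto simp: funpow_f_minus le_max_iff_disj)
    have "0 \<notin> Y"
    proof
      assume "0 \<in> Y"
      moreover have "0 \<notin> uminus ` X" using \<open>0 \<notin> X\<close> by force
      ultimately have "0 \<in> (+) (of_real s) ` W \<or> 0 \<in> (+) (- of_real s) ` W"
        using \<open>0 \<notin> X\<close> unfolding Y_def by blast
      then obtain w where "w \<in> W" "of_real s + w = 0 \<or> - of_real s + w = 0" by auto
      then have "\<bar>Re w\<bar> = \<bar>s\<bar>" by (auto simp: complex_eq_iff)
      then show False using W_Re[OF \<open>w \<in> W\<close>] s C by simp
    qed
    define G where "G = connected_component_set (- Y) 0"
    have "open G" unfolding G_def using \<open>closed Y\<close> by (intro open_connected_component) auto
    have "0 \<in> G" using \<open>0 \<notin> Y\<close> by (simp add: G_def)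
    then obtain \<rho> where \<rho>: "\<rho> > 0" "ball 0 \<rho> \<subseteq> G" using \<open>open G\<close> open_contains_ball by blast
    have G_Y: "G \<inter> Y = {}" using connected_component_subset[of "- Y" 0] by (auto simp: G_def)
    have path_G: "\<exists>p. path p \<and> path_image p \<subseteq> G \<and> pathstart p = 0 \<and> pathfinish p = z" if "z \<in> G" for z
    proof -
      have "path_connected G"
        using \<open>open G\<close> by (simp add: connected_open_path_connected G_def)
      then show ?thesis using that \<open>0 \<in> G\<close> unfolding path_connected_def by blast
    qed
    have G_minus: "- z \<in> G" if zG: "z \<in> G" for z
    proof -
      obtain p where p: "path p" "path_image p \<subseteq> G" "pathstart p = 0" "pathfinish p = z"
        using path_G[OF zG] by blast
      have "connected (uminus ` path_image p)"
        using p(1) by (intro connected_continuous_image connected_path_image continuous_intros)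
      moreover have "uminus ` path_image p \<subseteq> - Y"
        using p(2) G_Y Y_minus by force
      moreover have "0 \<in> uminus ` path_image p" "- z \<in> uminus ` path_image p"
        using p(3,4) pathstart_in_path_image[of p] pathfinish_in_path_image[of p] by force+
      ultimately show ?thesis unfolding G_def
        by (metis connected_component_def mem_Collect_eq)
    qed
    \<comment> \<open>A path in G from 0 to the far side of the right translate of W would meet it,
      although it is part of Y.\<close>
    have G_Re_less: "Re z < A" if z: "z \<in> G" for z
    proof (rule ccontr)
      assume "\<not> Re z < A"
      obtain p where p: "path p" "path_image p \<subseteq> G" "pathstart p = 0" "pathfinish p = z"
        using path_G[OF z] by blast
      define h where "h = (\<lambda>z. z - of_real s) \<circ> p"
      have "bounded (path_image p)" using p(1) by (rule bounded_path_image)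
      then obtain T where T: "\<And>z. z \<in> path_image p \<Longrightarrow> norm z < T"
        unfolding bounded_iff by (metis gt_ex le_less_trans)
      obtain v where v: "path v" "path_image v \<subseteq> W" "Im (pathstart v) \<le> - T" "Im (pathfinish v) \<ge> T"
        using crossW by blast
      have "path_image h \<inter> path_image v \<noteq> {}"
      proof (rule crossing_paths_intersect[of _ T "C + 1"])
        show "path h" unfolding h_def using p(1)
          by (intro path_continuous_image continuous_intros)
        show "\<bar>Im z\<bar> < T" if "z \<in> path_image h" for z
          using that T abs_Im_le_cmod le_less_trans by (fastforce simp: h_def path_image_compose)
        show "Re (pathstart h) \<le> - (C + 1)" "Re (pathfinish h) \<ge> C + 1"
          using p s \<open>\<not> Re z < A\<close> by (auto simp: h_def pathstart_compose pathfinish_compose A_def)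
        show "\<bar>Re z\<bar> < C + 1" if "z \<in> path_image v" for z
          using W_Re[of z] that v(2) by auto
      qed (use v in auto)
      then obtain y where "y \<in> path_image p" "y - of_real s \<in> W"
        using v(2) by (auto simp: h_def path_image_compose)
      then have "y \<in> Y" unfolding Y_def by force
      then show False using \<open>y \<in> path_image p\<close> p(2) G_Y by blast
    qed
    have G_Re: "\<bar>Re z\<bar> < A" if "z \<in> G" for z
      using G_Re_less[OF that] G_Re_less[OF G_minus[OF that]] by simp
    show False
    proof (cases "bounded G")
      case True
      obtain N where N: "\<And>j. j \<ge> N \<Longrightarrow> \<exists>z\<in>ball 0 \<rho>. max B BX < norm ((f ^^ (Q * j)) z)"
        using iterates_unbounded_near_0[OF \<rho>(1)] by metis
      \<comment> \<open>The summand 2 ensures n >= 2, where the bound on Y holds.\<close>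
      define n where "n = Q * (N + 2)"
      have "1 * 2 \<le> n" unfolding n_def using Q_pos by (intro mult_le_mono) auto
      obtain z where z: "z \<in> ball 0 \<rho>" "max B BX < norm ((f ^^ n) z)"
        using N[of "N + 2"] by (auto simp: n_def)
      have "norm ((f ^^ n) z) \<le> max B BX"
      proof (rule maximum_modulus_frontier[OF funpow_f_holomorphic funpow_f_continuous True])
        fix w assume "w \<in> frontier G"
        moreover have "frontier G \<subseteq> Y"
          using frontier_of_connected_component_subset[of "- Y" 0] frontier_subset_closed[OF \<open>closed Y\<close>]
          by (simp add: G_def frontier_complement)
        ultimately show "norm ((f ^^ n) w) \<le> max B BX" using Y_B \<open>1 * 2 \<le> n\<close> by auto
      qed (use z \<rho> in auto)
      then show False using z(2) by simp
    next
      case False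
      have "bounded X" using \<open>compact X\<close> by (rule compact_imp_bounded)
      then obtain T where T: "\<And>z. z \<in> X \<Longrightarrow> norm z < T"
        unfolding bounded_iff by (metis gt_ex le_less_trans)
      \<comment> \<open>G is unbounded inside the strip |Re| < A, so it has a point beyond the
        height of X; joined through 0 to its negative, it gives a vertical crossing.\<close>
      obtain z where z: "z \<in> G" "norm z > A + T" using False unfolding bounded_iff by (meson not_le)
      have "\<bar>Im z\<bar> > T" using z G_Re[OF z(1)] cmod_le[of z] by linarith
      obtain p where p: "path p" "path_image p \<subseteq> G" "pathstart p = 0" "pathfinish p = z"
        using path_G[OF z(1)] by blast
      define m where "m = uminus \<circ> p"
      have m: "path m" "pathstart m = 0" "pathfinish m = - z" "path_image m \<subseteq> G"
        using p G_minus by (auto simp: m_def pathstart_compose pathfinish_compose path_image_compose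
            intro!: path_continuous_image continuous_intros)
      define v where "v = (if Im z > 0 then reversepath m +++ p else reversepath p +++ m)"
      have "path_image g \<inter> path_image v \<noteq> {}"
      proof (rule crossing_paths_intersect[of _ T A])
        show "path v" using p m by (simp add: v_def)
        have img: "path_image v \<subseteq> G" using p m by (auto simp: v_def path_image_join)
        show "\<bar>Re z\<bar> < A" if "z \<in> path_image v" for z using that img G_Re by blast
        show "Im (pathstart v) \<le> - T" "Im (pathfinish v) \<ge> T"
          using \<open>\<bar>Im z\<bar> > T\<close> p m by (auto simp: v_def)
        show "\<bar>Im z\<bar> < T" if "z \<in> path_image g" for z
          using T[of z] that abs_Im_le_cmod[of z] by (simp add: X_def)
      qed (use g in auto)
      moreover have "path_image v \<subseteq> G" using p m by (auto simp: v_def path_image_join)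
      ultimately show False using G_Y by (auto simp: Y_def X_def)
    qed
  qed
  show ?thesis
  proof (rule that[of D], rule ccontr)
    fix \<gamma> assume \<gamma>: "path \<gamma>" "path_image \<gamma> \<subseteq> F"
      and "\<not> \<bar>Re (pathfinish \<gamma>) - Re (pathstart \<gamma>)\<bar> \<le> D"
    then consider "Re (pathfinish \<gamma>) - Re (pathstart \<gamma>) > D" | "Re (pathstart \<gamma>) - Re (pathfinish \<gamma>) > D"
      by linarith
    then show False
      using main[of \<gamma>] main[of "reversepath \<gamma>"] \<gamma> by cases auto
  qed
qed

text \<open>f^n maps paths in the component to paths in F, and the orbit of z is bounded, so all
  iterates have real part at most S in modulus. A point of great height would then gain at least 1
  in |Im| at each step, against the boundedness of its orbit.\<close>

lemma components_of_F_bounded: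
  assumes z: "z \<in> F"
  shows "bounded (connected_component_set F z)"
proof -
  obtain D where D: "\<And>\<gamma>. path \<gamma> \<Longrightarrow> path_image \<gamma> \<subseteq> F \<Longrightarrow> \<bar>Re (pathfinish \<gamma>) - Re (pathstart \<gamma>)\<bar> \<le> D"
    using horizontal_extent_of_paths_in_F by blast
  obtain Bz where Bz: "\<And>n. norm ((f ^^ n) z) \<le> Bz"
    using orbits_bounded_on_compact_in_F[of "{z}"] z by auto
  define S where "S = D + Bz"
  define U where "U = connected_component_set F z"
  have U: "open U" "connected U" "z \<in> U" "U \<subseteq> F"
    using open_connected_component[OF open_F] connected_component_subset z
    by (auto simp: U_def connected_component_subset)
  have Re_S: "\<bar>Re ((f ^^ n) y)\<bar> \<le> S" if "y \<in> U" for n y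
  proof -
    obtain p where p: "path p" "path_image p \<subseteq> U" "pathstart p = z" "pathfinish p = y"
      using connected_open_path_connected[OF U(1,2)] U(3) \<open>y \<in> U\<close> unfolding path_connected_def by blast
    have "path ((f ^^ n) \<circ> p)" using p(1) by (intro path_continuous_image funpow_f_continuous)
    moreover have "path_image ((f ^^ n) \<circ> p) \<subseteq> F"
      using p(2) U(4) funpow_f_in_F by (auto simp: path_image_compose)
    ultimately have "\<bar>Re ((f ^^ n) y) - Re ((f ^^ n) z)\<bar> \<le> D"
      using D[of "(f ^^ n) \<circ> p"] p by (simp add: pathstart_compose pathfinish_compose)
    then show ?thesis using Bz[of n] abs_Re_le_cmod[of "(f ^^ n) z"] by (simp add: S_def)
  qed
  \<comment> \<open>Y >= h gives Y >= 8 and |S| <= Y/4 - 2; with exp Y >= 1 + 5 Y this yields sinh Y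
    - |S| >= Y + 1.\<close>
  define h where "h = 4 * (\<bar>S\<bar> + 2)"
  have growth: "(exp Y - exp (- Y)) / 2 - \<bar>S\<bar> \<ge> Y + 1" if "Y \<ge> h" for Y
  proof -
    have Y: "Y \<ge> 8" "\<bar>S\<bar> \<le> Y / 4 - 2" using that by (auto simp: h_def)
    have "exp Y \<ge> 1 + Y + Y\<^sup>2 / 2" using Y by (intro exp_lower_Taylor_quadratic) auto
    moreover have "Y\<^sup>2 \<ge> 8 * Y" using Y(1) by (simp add: power2_eq_square)
    ultimately have E: "exp Y \<ge> 1 + 5 * Y" by linarith
    define e where "e = exp (- Y)"
    have "e \<le> 1" using Y(1) by (simp add: e_def)
    then show ?thesis using E Y unfolding e_def[symmetric] by argo
  qed
  have Im_h: "\<bar>Im y\<bar> < h" if y: "y \<in> U" for y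
  proof (rule ccontr)
    assume "\<not> \<bar>Im y\<bar> < h"
    then have h: "\<bar>Im y\<bar> \<ge> h" by simp
    have inc: "\<bar>Im ((f ^^ n) y)\<bar> \<ge> \<bar>Im y\<bar> + real n" for n
    proof (induction n)
      case (Suc n)
      define w where "w = (f ^^ n) y"
      have "\<bar>Im w\<bar> \<ge> h" using Suc h by (simp add: w_def)
      from growth[OF this] have "norm (f w) \<ge> \<bar>Im w\<bar> + 1 + \<bar>S\<bar>"
        using norm_f_bounds(2)[of w] by linarith
      moreover have "\<bar>Re (f w)\<bar> \<le> S" using Re_S[OF y, of "Suc n"] by (simp add: w_def)
      ultimately have "\<bar>Im (f w)\<bar> \<ge> \<bar>Im w\<bar> + 1" using cmod_le[of "f w"] by linarith
      then show ?case using Suc by (simp add: w_def)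
    qed simp
    obtain By where By: "\<And>n. norm ((f ^^ n) y) \<le> By"
      using orbits_bounded_on_compact_in_F[of "{y}"] y U(4) by auto
    obtain n :: nat where "By < real n" using reals_Archimedean2 by blast
    then show False
      using By[of n] inc[of n] abs_Im_le_cmod[of "(f ^^ n) y"] by linarith
  qed
  have "norm y \<le> S + h" if "y \<in> U" for y
    using Re_S[OF that, of 0] Im_h[OF that] cmod_le[of y] by simp
  then show ?thesis unfolding U_def[symmetric] bounded_iff by blast
qed

end

theorem mainTheorem2:
  fixes p q :: int and lam :: complex
  assumes "q \<noteq> 0" and "coprime p q"
    and "lam = exp (2 * of_real pi * \<i> * of_int p / of_int q)"
  shows "\<forall>z \<in> fatou_set (\<lambda>w. lam * sin w).
           bounded (connected_component_set (fatou_set (\<lambda>w. lam * sin w)) z)"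
proof -
  \<comment> \<open>q may be negative: the exponent is |q|, and the sign passes to the integer
    \<open>sgn q * p\<close>.\<close>
  define Q where "Q = nat \<bar>q\<bar>"
  have Q: "Q > 0" using assms(1) by (simp add: Q_def)
  have lam: "lam = cis (2 * pi * p / q)"
    unfolding assms(3) cis_conv_exp by (rule arg_cong[of _ _ exp]) simp
  have "real Q = \<bar>real_of_int q\<bar>" by (simp add: Q_def)
  then have "real Q * (2 * pi * p / q) = 2 * pi * of_int (sgn q * p)"
    using assms(1) by (simp add: abs_if sgn_if)
  then have "lam ^ Q = cis (2 * pi * of_int (sgn q * p))"
    unfolding lam Complex.DeMoivre by (rule arg_cong[of _ _ cis])
  then have "lam ^ Q = 1" using cis_multiple_2pi[of "of_int (sgn q * p)"] by simp
  then interpret parabolic_sine lam Q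
    using Q by unfold_locales (simp_all add: lam)
  show ?thesis using components_of_F_bounded unfolding f_def by blast
qed

end
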